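(* Let $\mathcal{M}=(\mathcal{M},I,\otimes)$ be a large monoidal category, $\mathcal{C}$ a large category and $\Phi=(\Phi,\overline{\phi}_\cdot,\overline{\phi})$ a metamodel of $\mathcal{M}$ in $\mathcal{C}$. Then the functors $$\mathrm{Sem}\colon \mathbf{Th}(\widehat{\mathcal{M}})^{\mathrm{op}}\longrightarrow \mathbf{CAT}/\mathcal{C},\qquad \mathrm{Str}\colon \mathbf{CAT}/\mathcal{C}\longrightarrow \mathbf{Th}(\widehat{\mathcal{M}})^{\mathrm{op}}$$ (defined in the context) form an adjunction, with $\mathrm{Str}$ left adjoint to $\mathrm{Sem}$.
   Context: Sizes: fix universes $\mathcal U_1\in\mathcal U_2\in\mathcal U_3$; "small", "large", "huge" mean being an element of $\mathcal U_1,\mathcal U_2,\mathcal U_3$ respectively. $\mathbf{SET}$ is the category of large sets, and $\mathbf{CAT}$ the category of large categories and functors; $\mathbf{CAT}/\mathcal C$ is the slice category. Metamodel. A metamodel of a large monoidal category $\mathcal{M}$ in a large category $\mathcal{C}$ consists of a functor $\Phi\colon\mathcal{M}^{\mathrm{op}}\times\mathcal{C}^{\mathrm{op}}\times\mathcal{C}\to\mathbf{SET}$, written $(X,A,B)\mapsto\Phi_X(A,B)$; a natural (in the extranatural sense where appropriate) family $(\overline{\phi}_\cdot)_C\colon 1\to\Phi_I(C,C)$ ($C\in\mathcal C$); and a natural (in $X,Y,A,C$, extranatural in $B$) family $(\overline{\phi}_{X,Y})_{A,B,C}\colon\Phi_Y(B,C)\times\Phi_X(A,B)\to\Phi_{Y\otimes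 X}(A,C)$; such that, modulo the coherence isomorphisms of $\mathcal{M}$ (to which $\Phi$ is applied), $\overline\phi$ is associative and $\overline{\phi}_\cdot$ is a left and right unit for it: for $x\in\Phi_X(A,B)$, $y\in\Phi_Y(B,C)$, $z\in\Phi_Z(C,D)$, the elements $\overline\phi_{X,I}((\overline\phi_\cdot)_B(\ast),x)\in\Phi_{I\otimes X}(A,B)$ and $\overline\phi_{I,X}(x,(\overline\phi_\cdot)_A(\ast))\in\Phi_{X\otimes I}(A,B)$ correspond to $x$ under $\Phi_{I\otimes X}(A,B)\cong\Phi_X(A,B)\cong\Phi_{X\otimes I}(A,B)$, and $\overline\phi_{X,Z\otimes Y}(\overline\phi_{Y,Z}(z,y),x)$ corresponds to $\overline\phi_{Y\otimes X,Z}(z,\overline\phi_{X,Y}(y,x))$ under $\Phi_{(Z\otimes Y)\otimes X}(A,D)\cong\Phi_{Z\otimes(Y\otimes X)}(A,D)$. $\mathbf{Th}(\widehat{\mathcal M})$. $\widehat{\mathcal M}=[\mathcal M^{\mathrm{op}},\mathbf{SET}]$ carries the Day convolution monoidal structure, with unit $\widehat I=\mathcal M(-,I)$ and $(Q\,\widehat\otimes\,P)(Z)=\int^{X,Y\in\mathcal M}\mathcal M(Z,Y\otimes X)\times Q(Y)\times P(X)$. $\mathbf{Th}(\widehat{\mathcal M})$ is the category of monoid objects in $\widehat{\mathcal M}$. Equivalently its objects are lax monoidal functors $\mathsf P=(P,\overline e,\overline m)\colon\mathcal M^{\mathrm{op}}\to\mathbf{SET}$, with $\overline e\colon1\to P(I)$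 and $\overline m_{X,Y}\colon P(Y)\times P(X)\to P(Y\otimes X)$, and its morphisms are monoidal natural transformations. $\mathrm{Sem}$. For $\mathsf P=(P,\overline e,\overline m)\in\mathbf{Th}(\widehat{\mathcal M})$, the category $\mathbf{Mod}(\mathsf P,(\mathcal C,\Phi))$ has as objects pairs $(C,\xi)$ where $C\in\mathcal C$ and $\xi=(\xi_X\colon P(X)\to\Phi_X(C,C))_{X\in\mathcal M}$ is natural and satisfies $\xi_I\circ\overline e=(\overline\phi_\cdot)_C$ and $\xi_{Y\otimes X}\circ\overline m_{X,Y}=(\overline\phi_{X,Y})_{C,C,C}\circ(\xi_Y\times\xi_X)$ for all $X,Y$. A morphism $(C,\xi)\to(C',\xi')$ is a morphism $f\colon C\to C'$ in $\mathcal C$ with $\Phi_X(C,f)\circ\xi_X=\Phi_X(f,C')\circ\xi'_X$ for all $X$. $\mathrm{Sem}(\mathsf P)$ is the forgetful functor $\mathbf{Mod}(\mathsf P,(\mathcal C,\Phi))\to\mathcal C$, $(C,\xi)\mapsto C$; $\mathrm{Sem}$ acts on morphisms of $\mathbf{Th}(\widehat{\mathcal M})$ by precomposition on $\xi$. $\mathrm{Str}$. For $V\colon\mathcal A\to\mathcal C$ in $\mathbf{CAT}/\mathcal C$, $\mathrm{Str}(V)=(P^{(V)},\overline{e^{(V)}},\overline{m^{(V)}})$ with $P^{(V)}(X)=\int_{A\in\mathcal A}\Phi_X(VA,VA)$ (end), $\overline{e^{(V)}}$ the map selecting $((\overline\phi_\cdot)_{VA}(\ast))_{A\in\mathcal A}$,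 and $\overline{m^{(V)}}_{X,Y}((y_A)_A,(x_A)_A)=((\overline\phi_{X,Y})_{VA,VA,VA}(y_A,x_A))_{A}$; $\mathrm{Str}$ acts on morphisms of $\mathbf{CAT}/\mathcal C$ by reindexing of ends. *)

theory Defs
  imports Main "HOL-Library.FuncSet"
begin

section \<open>Universes and sets\<close>

text \<open>
  A type of class \<open>universe\<close> plays the role of the Grothendieck universe whose elements are
  the large sets: each \<open>x\<close> of the type is a set whose elements are \<open>elts x\<close>. Infinity is not
  assumed, so the universe of hereditarily finite sets is admitted too.
\<close>

class universe =
  fixes elts :: "'a \<Rightarrow> 'a set"
  assumes elts_inject: "elts x = elts y \<Longrightarrow> x = y"
    and wf_elts: "wf {(x, y). x \<in> elts y}"
    and subset_closed: "A \<subseteq> elts x \<Longrightarrow> A \<in> range elts"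
    and pair_closed: "{x, y} \<in> range elts"
    and power_closed: "{y. elts y \<subseteq> elts x} \<in> range elts"
    and union_closed: "(\<Union>i\<in>elts x. elts (f i)) \<in> range elts"

definition large :: "'v::universe set \<Rightarrow> bool" where
  "large A \<longleftrightarrow> A \<in> range elts"

text \<open>The set with given elements; meaningful only if \<open>A\<close> is large.\<close>

definition vset :: "'v::universe set \<Rightarrow> 'v" where
  "vset A = inv elts A"

definition vpair :: "'v::universe \<Rightarrow> 'v \<Rightarrow> 'v" where
  "vpair a b = vset {vset {a}, vset {a, b}}"

definition vfst :: "'v::universe \<Rightarrow> 'v" where
  "vfst p = (THE a. \<exists>b. p = vpair a b)"

definition vsnd :: "'v::universe \<Rightarrow> 'v" where
  "vsnd p = (THE b. \<exists>a. p = vpair a b)"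

text \<open>Functions inside the universe, coded by their graphs, and dependent products.\<close>

definition vlam :: "'v::universe set \<Rightarrow> ('v \<Rightarrow> 'v) \<Rightarrow> 'v" where
  "vlam D f = vset ((\<lambda>a. vpair a (f a)) ` D)"

definition vapp :: "'v::universe \<Rightarrow> 'v \<Rightarrow> 'v" where
  "vapp g a = (THE b. vpair a b \<in> elts g)"

definition vPi :: "'v::universe set \<Rightarrow> ('v \<Rightarrow> 'v set) \<Rightarrow> 'v set" where
  "vPi D F = {vlam D f | f. \<forall>a\<in>D. f a \<in> F a}"


section \<open>Categories and functors\<close>

record ('o, 'm) category =
  Obj :: "'o set"
  Arr :: "'m set"
  Dom :: "'m \<Rightarrow> 'o"
  Cod :: "'m \<Rightarrow> 'o"
  Ident :: "'o \<Rightarrow> 'm"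
  Comp :: "'m \<Rightarrow> 'm \<Rightarrow> 'm"

definition hom :: "('o, 'm) category \<Rightarrow> 'o \<Rightarrow> 'o \<Rightarrow> 'm set" where
  "hom C a b = {f \<in> Arr C. Dom C f = a \<and> Cod C f = b}"

text \<open>
  The last four assumptions fix the operations outside their domain of definition, so that
  equality of records is equality of categories.
\<close>

locale category =
  fixes C :: "('o, 'm) category"
  assumes dom_obj: "f \<in> Arr C \<Longrightarrow> Dom C f \<in> Obj C"
    and cod_obj: "f \<in> Arr C \<Longrightarrow> Cod C f \<in> Obj C"
    and ident_hom: "a \<in> Obj C \<Longrightarrow> Ident C a \<in> hom C a a"
    and comp_hom: "f \<in> hom C a b \<Longrightarrow> g \<in> hom C b c \<Longrightarrow> Comp C g f \<in> hom C a c"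
    and comp_ident_left: "f \<in> hom C a b \<Longrightarrow> Comp C (Ident C b) f = f"
    and comp_ident_right: "f \<in> hom C a b \<Longrightarrow> Comp C f (Ident C a) = f"
    and comp_assoc: "f \<in> hom C a b \<Longrightarrow> g \<in> hom C b c \<Longrightarrow> h \<in> hom C c d \<Longrightarrow>
        Comp C (Comp C h g) f = Comp C h (Comp C g f)"
    and dom_ext: "Dom C \<in> extensional (Arr C)"
    and cod_ext: "Cod C \<in> extensional (Arr C)"
    and ident_ext: "Ident C \<in> extensional (Obj C)"
    and comp_ext: "\<not> (f \<in> Arr C \<and> g \<in> Arr C \<and> Dom C g = Cod C f) \<Longrightarrow> Comp C g f = undefined"

definition mk_category ::
    "'o set \<Rightarrow> 'm set \<Rightarrow> ('m \<Rightarrow> 'o) \<Rightarrow> ('m \<Rightarrow> 'o) \<Rightarrow> ('o \<Rightarrow> 'm) \<Rightarrow> ('m \<Rightarrow> 'm \<Rightarrow> 'm) \<Rightarrow>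
      ('o, 'm) category" where
  "mk_category Ob Ar d c i k =
     \<lparr>Obj = Ob, Arr = Ar, Dom = restrict d Ar, Cod = restrict c Ar, Ident = restrict i Ob,
      Comp = (\<lambda>g f. if f \<in> Ar \<and> g \<in> Ar \<and> d g = c f then k g f else undefined)\<rparr>"

definition opp :: "('o, 'm) category \<Rightarrow> ('o, 'm) category" where
  "opp C = mk_category (Obj C) (Arr C) (Cod C) (Dom C) (Ident C) (\<lambda>g f. Comp C f g)"

definition prod_cat :: "('o, 'm) category \<Rightarrow> ('p, 'n) category \<Rightarrow> ('o \<times> 'p, 'm \<times> 'n) category"
    (infixr "\<times>\<^sub>C" 70) where
  "A \<times>\<^sub>C B = mk_category (Obj A \<times> Obj B) (Arr A \<times> Arr B)
     (\<lambda>(f, g). (Dom A f, Dom B g)) (\<lambda>(f, g). (Cod A f, Cod B g))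
     (\<lambda>(a, b). (Ident A a, Ident B b))
     (\<lambda>(f', g') (f, g). (Comp A f' f, Comp B g' g))"

record ('o, 'm, 'p, 'n) func =
  OMap :: "'o \<Rightarrow> 'p"
  AMap :: "'m \<Rightarrow> 'n"

locale is_functor = A: category A + B: category B
  for A :: "('o, 'm) category" and B :: "('p, 'n) category" +
  fixes F :: "('o, 'm, 'p, 'n) func"
  assumes omap_obj: "a \<in> Obj A \<Longrightarrow> OMap F a \<in> Obj B"
    and amap_hom: "f \<in> hom A a b \<Longrightarrow> AMap F f \<in> hom B (OMap F a) (OMap F b)"
    and amap_ident: "a \<in> Obj A \<Longrightarrow> AMap F (Ident A a) = Ident B (OMap F a)"
    and amap_comp: "f \<in> hom A a b \<Longrightarrow> g \<in> hom A b c \<Longrightarrow>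
        AMap F (Comp A g f) = Comp B (AMap F g) (AMap F f)"
    and omap_ext: "OMap F \<in> extensional (Obj A)"
    and amap_ext: "AMap F \<in> extensional (Arr A)"

definition mk_func ::
    "('o, 'm) category \<Rightarrow> ('o \<Rightarrow> 'p) \<Rightarrow> ('m \<Rightarrow> 'n) \<Rightarrow> ('o, 'm, 'p, 'n) func" where
  "mk_func A fo fa = \<lparr>OMap = restrict fo (Obj A), AMap = restrict fa (Arr A)\<rparr>"

definition id_func :: "('o, 'm) category \<Rightarrow> ('o, 'm, 'o, 'm) func" where
  "id_func A = mk_func A (\<lambda>a. a) (\<lambda>f. f)"

definition comp_func ::
    "('o, 'm) category \<Rightarrow> ('p, 'n, 'q, 'l) func \<Rightarrow> ('o, 'm, 'p, 'n) func \<Rightarrow>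
      ('o, 'm, 'q, 'l) func" where
  "comp_func A G F = mk_func A (\<lambda>a. OMap G (OMap F a)) (\<lambda>f. AMap G (AMap F f))"

locale nat_trans = F: is_functor A B F + G: is_functor A B G
  for A :: "('o, 'm) category" and B :: "('p, 'n) category"
    and F :: "('o, 'm, 'p, 'n) func" and G :: "('o, 'm, 'p, 'n) func" +
  fixes t :: "'o \<Rightarrow> 'n"
  assumes component: "a \<in> Obj A \<Longrightarrow> t a \<in> hom B (OMap F a) (OMap G a)"
    and natural: "f \<in> hom A a b \<Longrightarrow> Comp B (t b) (AMap F f) = Comp B (AMap G f) (t a)"
    and component_ext: "t \<in> extensional (Obj A)"

definition is_iso :: "('o, 'm) category \<Rightarrow> 'm \<Rightarrow> bool" where
  "is_iso C f \<longleftrightarrow> (\<exists>a b. f \<in> hom C a b \<and>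
     (\<exists>g\<in>hom C b a. Comp C g f = Ident C a \<and> Comp C f g = Ident C b))"

text \<open>\<open>F : A \<rightarrow> B\<close> is left adjoint to \<open>G : B \<rightarrow> A\<close>.\<close>

definition left_adjoint ::
    "('o, 'm) category \<Rightarrow> ('p, 'n) category \<Rightarrow> ('o, 'm, 'p, 'n) func \<Rightarrow> ('p, 'n, 'o, 'm) func \<Rightarrow>
      bool" where
  "left_adjoint A B F G \<longleftrightarrow>
     is_functor A B F \<and> is_functor B A G \<and>
     (\<exists>\<theta>. (\<forall>a\<in>Obj A. \<forall>b\<in>Obj B.
            bij_betw (\<theta> a b) (hom B (OMap F a) b) (hom A a (OMap G b))) \<and>
          (\<forall>a\<in>Obj A. \<forall>a'\<in>Obj A. \<forall>b\<in>Obj B. \<forall>b'\<in>Obj B.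
            \<forall>f\<in>hom A a' a. \<forall>g\<in>hom B b b'. \<forall>h\<in>hom B (OMap F a) b.
              \<theta> a' b' (Comp B g (Comp B h (AMap F f))) =
              Comp A (AMap G g) (Comp A (\<theta> a b h) f)))"


section \<open>Large sets, large categories, slices\<close>

text \<open>An arrow that carries its source and target.\<close>

datatype ('o, 'f) arrow = Arrow (Src: 'o) (Map: 'f) (Tgt: 'o)

type_synonym 'v set_arrow = "('v, 'v \<Rightarrow> 'v) arrow"

definition SET :: "('v::universe, 'v set_arrow) category" where
  "SET = mk_category UNIV {f. Map f \<in> elts (Src f) \<rightarrow>\<^sub>E elts (Tgt f)} Src Tgt
     (\<lambda>x. Arrow x (\<lambda>a\<in>elts x. a) x)
     (\<lambda>g f. Arrow (Src f) (compose (elts (Src f)) (Map g) (Map f)) (Tgt g))"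

locale large_category = category C for C :: "('v::universe, 'v) category" +
  assumes large_obj: "large (Obj C)"
    and large_arr: "large (Arr C)"

type_synonym 'v cat_arrow = "(('v, 'v) category, ('v, 'v, 'v, 'v) func) arrow"

definition CAT :: "(('v::universe, 'v) category, 'v cat_arrow) category" where
  "CAT = mk_category {A. large_category A}
     {F. large_category (Src F) \<and> large_category (Tgt F) \<and> is_functor (Src F) (Tgt F) (Map F)}
     Src Tgt
     (\<lambda>A. Arrow A (id_func A) A)
     (\<lambda>G F. Arrow (Src F) (comp_func (Src F) (Map G) (Map F)) (Tgt G))"

definition slice :: "('o, 'm) category \<Rightarrow> 'o \<Rightarrow> ('m, ('m, 'm) arrow) category" where
  "slice K c = mk_category {v \<in> Arr K. Cod K v = c}
     {f. Src f \<in> Arr K \<and> Cod K (Src f) = c \<and> Tgt f \<in> Arr K \<and> Cod K (Tgt f) = c \<and>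
         Map f \<in> hom K (Dom K (Src f)) (Dom K (Tgt f)) \<and> Comp K (Tgt f) (Map f) = Src f}
     Src Tgt
     (\<lambda>v. Arrow v (Ident K (Dom K v)) v)
     (\<lambda>g f. Arrow (Src f) (Comp K (Map g) (Map f)) (Tgt g))"

text \<open>The end of \<open>T : A\<^sup>o\<^sup>p \<times> A \<rightarrow> SET\<close>, as the set of compatible families.\<close>

definition end_SET ::
    "('v::universe, 'v) category \<Rightarrow> ('v \<times> 'v, 'v \<times> 'v, 'v, 'v set_arrow) func \<Rightarrow> 'v" where
  "end_SET A T = vset {x \<in> vPi (Obj A) (\<lambda>a. elts (OMap T (a, a))).
     \<forall>a\<in>Obj A. \<forall>b\<in>Obj A. \<forall>f\<in>hom A a b.
       Map (AMap T (Ident A a, f)) (vapp x a) = Map (AMap T (f, Ident A b)) (vapp x b)}"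


section \<open>Monoidal categories and metamodels\<close>

record ('o, 'm) moncat =
  Cat :: "('o, 'm) category"
  Unit :: 'o
  Tensor :: "('o \<times> 'o, 'm \<times> 'm, 'o, 'm) func"
  Assoc :: "'o \<Rightarrow> 'o \<Rightarrow> 'o \<Rightarrow> 'm"
  LUnit :: "'o \<Rightarrow> 'm"
  RUnit :: "'o \<Rightarrow> 'm"

abbreviation tensor_obj :: "('o, 'm) moncat \<Rightarrow> 'o \<Rightarrow> 'o \<Rightarrow> 'o" where
  "tensor_obj M X Y \<equiv> OMap (Tensor M) (X, Y)"

abbreviation tensor_arr :: "('o, 'm) moncat \<Rightarrow> 'm \<Rightarrow> 'm \<Rightarrow> 'm" where
  "tensor_arr M f g \<equiv> AMap (Tensor M) (f, g)"

locale monoidal_category =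
  category "Cat M" + tensor: is_functor "Cat M \<times>\<^sub>C Cat M" "Cat M" "Tensor M"
  for M :: "('o, 'm) moncat" +
  assumes unit_obj: "Unit M \<in> Obj (Cat M)"
    and assoc_hom: "X \<in> Obj (Cat M) \<Longrightarrow> Y \<in> Obj (Cat M) \<Longrightarrow> Z \<in> Obj (Cat M) \<Longrightarrow>
        Assoc M X Y Z \<in> hom (Cat M) (tensor_obj M (tensor_obj M X Y) Z)
                                      (tensor_obj M X (tensor_obj M Y Z))"
    and assoc_iso: "X \<in> Obj (Cat M) \<Longrightarrow> Y \<in> Obj (Cat M) \<Longrightarrow> Z \<in> Obj (Cat M) \<Longrightarrow>
        is_iso (Cat M) (Assoc M X Y Z)"
    and assoc_natural: "f \<in> hom (Cat M) X X' \<Longrightarrow> g \<in> hom (Cat M) Y Y' \<Longrightarrow> h \<in> hom (Cat M) Z Z' \<Longrightarrow>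
        Comp (Cat M) (Assoc M X' Y' Z') (tensor_arr M (tensor_arr M f g) h) =
        Comp (Cat M) (tensor_arr M f (tensor_arr M g h)) (Assoc M X Y Z)"
    and lunit_hom: "X \<in> Obj (Cat M) \<Longrightarrow> LUnit M X \<in> hom (Cat M) (tensor_obj M (Unit M) X) X"
    and lunit_iso: "X \<in> Obj (Cat M) \<Longrightarrow> is_iso (Cat M) (LUnit M X)"
    and lunit_natural: "f \<in> hom (Cat M) X X' \<Longrightarrow>
        Comp (Cat M) (LUnit M X') (tensor_arr M (Ident (Cat M) (Unit M)) f) =
        Comp (Cat M) f (LUnit M X)"
    and runit_hom: "X \<in> Obj (Cat M) \<Longrightarrow> RUnit M X \<in> hom (Cat M) (tensor_obj M X (Unit M)) X"
    and runit_iso: "X \<in> Obj (Cat M) \<Longrightarrow> is_iso (Cat M) (RUnit M X)"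
    and runit_natural: "f \<in> hom (Cat M) X X' \<Longrightarrow>
        Comp (Cat M) (RUnit M X') (tensor_arr M f (Ident (Cat M) (Unit M))) =
        Comp (Cat M) f (RUnit M X)"
    and pentagon: "W \<in> Obj (Cat M) \<Longrightarrow> X \<in> Obj (Cat M) \<Longrightarrow> Y \<in> Obj (Cat M) \<Longrightarrow> Z \<in> Obj (Cat M) \<Longrightarrow>
        Comp (Cat M) (Assoc M W X (tensor_obj M Y Z)) (Assoc M (tensor_obj M W X) Y Z) =
        Comp (Cat M) (tensor_arr M (Ident (Cat M) W) (Assoc M X Y Z))
          (Comp (Cat M) (Assoc M W (tensor_obj M X Y) Z)
            (tensor_arr M (Assoc M W X Y) (Ident (Cat M) Z)))"
    and triangle: "X \<in> Obj (Cat M) \<Longrightarrow> Y \<in> Obj (Cat M) \<Longrightarrow>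
        Comp (Cat M) (tensor_arr M (Ident (Cat M) X) (LUnit M Y)) (Assoc M X (Unit M) Y) =
        tensor_arr M (RUnit M X) (Ident (Cat M) Y)"

locale large_monoidal_category = monoidal_category M + large_category "Cat M"
  for M :: "('v::universe, 'v) moncat"

text \<open>
  \<open>PhiUnit \<Phi> C\<close> is the element of \<open>\<Phi>\<^sub>I(C, C)\<close> selected by the unit, and \<open>PhiMul \<Phi> X Y A B C y x\<close>
  is the value of \<open>\<Phi>\<^sub>Y(B, C) \<times> \<Phi>\<^sub>X(A, B) \<rightarrow> \<Phi>\<^bsub>Y \<otimes> X\<^esub>(A, C)\<close> at \<open>(y, x)\<close>.
\<close>

record 'v metamodel_data =
  Phi :: "('v \<times> 'v \<times> 'v, 'v \<times> 'v \<times> 'v, 'v, 'v set_arrow) func"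
  PhiUnit :: "'v \<Rightarrow> 'v"
  PhiMul :: "'v \<Rightarrow> 'v \<Rightarrow> 'v \<Rightarrow> 'v \<Rightarrow> 'v \<Rightarrow> 'v \<Rightarrow> 'v \<Rightarrow> 'v"

definition Phi_obj :: "'v::universe metamodel_data \<Rightarrow> 'v \<Rightarrow> 'v \<Rightarrow> 'v \<Rightarrow> 'v set" where
  "Phi_obj \<Phi> X A B = elts (OMap (Phi \<Phi>) (X, A, B))"

definition Phi_arr :: "'v::universe metamodel_data \<Rightarrow> 'v \<Rightarrow> 'v \<Rightarrow> 'v \<Rightarrow> 'v \<Rightarrow> 'v" where
  "Phi_arr \<Phi> u f g = Map (AMap (Phi \<Phi>) (u, f, g))"

text \<open>Naturality of the multiplication in \<open>X, Y, A, C\<close> is stated jointly in these variables.\<close>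

locale metamodel =
  M: monoidal_category M + C: category C +
  Phi: is_functor "opp (Cat M) \<times>\<^sub>C opp C \<times>\<^sub>C C" SET "Phi \<Phi>"
  for M :: "('v::universe, 'v) moncat" and C :: "('v, 'v) category" and \<Phi> :: "'v metamodel_data" +
  assumes unit_type: "A \<in> Obj C \<Longrightarrow> PhiUnit \<Phi> A \<in> Phi_obj \<Phi> (Unit M) A A"
    and unit_extranatural: "f \<in> hom C A B \<Longrightarrow>
        Phi_arr \<Phi> (Ident (Cat M) (Unit M)) (Ident C A) f (PhiUnit \<Phi> A) =
        Phi_arr \<Phi> (Ident (Cat M) (Unit M)) f (Ident C B) (PhiUnit \<Phi> B)"
    and mul_type: "X \<in> Obj (Cat M) \<Longrightarrow> Y \<in> Obj (Cat M) \<Longrightarrow>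
        A \<in> Obj C \<Longrightarrow> B \<in> Obj C \<Longrightarrow> D \<in> Obj C \<Longrightarrow>
        y \<in> Phi_obj \<Phi> Y B D \<Longrightarrow> x \<in> Phi_obj \<Phi> X A B \<Longrightarrow>
        PhiMul \<Phi> X Y A B D y x \<in> Phi_obj \<Phi> (tensor_obj M Y X) A D"
    and mul_natural: "u \<in> hom (Cat M) X' X \<Longrightarrow> v \<in> hom (Cat M) Y' Y \<Longrightarrow>
        f \<in> hom C A' A \<Longrightarrow> B \<in> Obj C \<Longrightarrow> h \<in> hom C D D' \<Longrightarrow>
        y \<in> Phi_obj \<Phi> Y B D \<Longrightarrow> x \<in> Phi_obj \<Phi> X A B \<Longrightarrow>
        PhiMul \<Phi> X' Y' A' B D' (Phi_arr \<Phi> v (Ident C B) h y) (Phi_arr \<Phi> u f (Ident C B) x) =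
        Phi_arr \<Phi> (tensor_arr M v u) f h (PhiMul \<Phi> X Y A B D y x)"
    and mul_extranatural: "X \<in> Obj (Cat M) \<Longrightarrow> Y \<in> Obj (Cat M) \<Longrightarrow>
        A \<in> Obj C \<Longrightarrow> g \<in> hom C B B' \<Longrightarrow> D \<in> Obj C \<Longrightarrow>
        y \<in> Phi_obj \<Phi> Y B' D \<Longrightarrow> x \<in> Phi_obj \<Phi> X A B \<Longrightarrow>
        PhiMul \<Phi> X Y A B' D y (Phi_arr \<Phi> (Ident (Cat M) X) (Ident C A) g x) =
        PhiMul \<Phi> X Y A B D (Phi_arr \<Phi> (Ident (Cat M) Y) g (Ident C D) y) x"
    and mul_unit_left: "X \<in> Obj (Cat M) \<Longrightarrow> A \<in> Obj C \<Longrightarrow> B \<in> Obj C \<Longrightarrow> x \<in> Phi_obj \<Phi> X A B \<Longrightarrow>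
        PhiMul \<Phi> X (Unit M) A B B (PhiUnit \<Phi> B) x =
        Phi_arr \<Phi> (LUnit M X) (Ident C A) (Ident C B) x"
    and mul_unit_right: "X \<in> Obj (Cat M) \<Longrightarrow> A \<in> Obj C \<Longrightarrow> B \<in> Obj C \<Longrightarrow> x \<in> Phi_obj \<Phi> X A B \<Longrightarrow>
        PhiMul \<Phi> (Unit M) X A A B x (PhiUnit \<Phi> A) =
        Phi_arr \<Phi> (RUnit M X) (Ident C A) (Ident C B) x"
    and mul_assoc: "X \<in> Obj (Cat M) \<Longrightarrow> Y \<in> Obj (Cat M) \<Longrightarrow> Z \<in> Obj (Cat M) \<Longrightarrow>
        A \<in> Obj C \<Longrightarrow> B \<in> Obj C \<Longrightarrow> D \<in> Obj C \<Longrightarrow> E \<in> Obj C \<Longrightarrow>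
        x \<in> Phi_obj \<Phi> X A B \<Longrightarrow> y \<in> Phi_obj \<Phi> Y B D \<Longrightarrow> z \<in> Phi_obj \<Phi> Z D E \<Longrightarrow>
        PhiMul \<Phi> X (tensor_obj M Z Y) A B E (PhiMul \<Phi> Y Z B D E z y) x =
        Phi_arr \<Phi> (Assoc M Z Y X) (Ident C A) (Ident C E)
          (PhiMul \<Phi> (tensor_obj M Y X) Z A D E z (PhiMul \<Phi> X Y A B D y x))"


section \<open>The category of theories\<close>

text \<open>
  Monoid objects of the Day convolution monoidal category of presheaves on \<open>M\<close>, in the form of
  lax monoidal functors \<open>M\<^sup>o\<^sup>p \<rightarrow> SET\<close>; \<open>LMul P X Y y x\<close> is the value of
  \<open>P(Y) \<times> P(X) \<rightarrow> P(Y \<otimes> X)\<close> at \<open>(y, x)\<close>.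
\<close>

record 'v lax_data =
  LFun :: "('v, 'v, 'v, 'v set_arrow) func"
  LUnitElt :: 'v
  LMul :: "'v \<Rightarrow> 'v \<Rightarrow> 'v \<Rightarrow> 'v \<Rightarrow> 'v"

definition lax_obj :: "'v::universe lax_data \<Rightarrow> 'v \<Rightarrow> 'v set" where
  "lax_obj P X = elts (OMap (LFun P) X)"

definition lax_arr :: "'v::universe lax_data \<Rightarrow> 'v \<Rightarrow> 'v \<Rightarrow> 'v" where
  "lax_arr P u = Map (AMap (LFun P) u)"

locale lax_monoidal_functor =
  M: monoidal_category M + is_functor "opp (Cat M)" SET "LFun P"
  for M :: "('v::universe, 'v) moncat" and P :: "'v lax_data" +
  assumes lax_unit_type: "LUnitElt P \<in> lax_obj P (Unit M)"
    and lax_mul_type: "LMul P \<in> (\<Pi>\<^sub>E X\<in>Obj (Cat M). \<Pi>\<^sub>E Y\<in>Obj (Cat M).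
        lax_obj P Y \<rightarrow>\<^sub>E lax_obj P X \<rightarrow>\<^sub>E lax_obj P (tensor_obj M Y X))"
    and lax_mul_natural: "u \<in> hom (Cat M) X' X \<Longrightarrow> v \<in> hom (Cat M) Y' Y \<Longrightarrow>
        y \<in> lax_obj P Y \<Longrightarrow> x \<in> lax_obj P X \<Longrightarrow>
        LMul P X' Y' (lax_arr P v y) (lax_arr P u x) =
        lax_arr P (tensor_arr M v u) (LMul P X Y y x)"
    and lax_unit_left: "X \<in> Obj (Cat M) \<Longrightarrow> x \<in> lax_obj P X \<Longrightarrow>
        LMul P X (Unit M) (LUnitElt P) x = lax_arr P (LUnit M X) x"
    and lax_unit_right: "X \<in> Obj (Cat M) \<Longrightarrow> x \<in> lax_obj P X \<Longrightarrow>
        LMul P (Unit M) X x (LUnitElt P) = lax_arr P (RUnit M X) x"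
    and lax_assoc: "X \<in> Obj (Cat M) \<Longrightarrow> Y \<in> Obj (Cat M) \<Longrightarrow> Z \<in> Obj (Cat M) \<Longrightarrow>
        x \<in> lax_obj P X \<Longrightarrow> y \<in> lax_obj P Y \<Longrightarrow> z \<in> lax_obj P Z \<Longrightarrow>
        LMul P X (tensor_obj M Z Y) (LMul P Y Z z y) x =
        lax_arr P (Assoc M Z Y X) (LMul P (tensor_obj M Y X) Z z (LMul P X Y y x))"

locale monoidal_nat_trans =
  P: lax_monoidal_functor M P + Q: lax_monoidal_functor M Q +
  nat_trans "opp (Cat M)" SET "LFun P" "LFun Q" t
  for M :: "('v::universe, 'v) moncat" and P :: "'v lax_data" and Q :: "'v lax_data"
    and t :: "'v \<Rightarrow> 'v set_arrow" +
  assumes preserves_unit: "Map (t (Unit M)) (LUnitElt P) = LUnitElt Q"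
    and preserves_mul: "X \<in> Obj (Cat M) \<Longrightarrow> Y \<in> Obj (Cat M) \<Longrightarrow>
        y \<in> lax_obj P Y \<Longrightarrow> x \<in> lax_obj P X \<Longrightarrow>
        Map (t (tensor_obj M Y X)) (LMul P X Y y x) = LMul Q X Y (Map (t Y) y) (Map (t X) x)"

type_synonym 'v lax_arrow = "('v lax_data, 'v \<Rightarrow> 'v set_arrow) arrow"

definition Th :: "('v::universe, 'v) moncat \<Rightarrow> ('v lax_data, 'v lax_arrow) category" where
  "Th M = mk_category {P. lax_monoidal_functor M P}
     {t. monoidal_nat_trans M (Src t) (Tgt t) (Map t)}
     Src Tgt
     (\<lambda>P. Arrow P (\<lambda>X\<in>Obj (Cat M). Ident SET (OMap (LFun P) X)) P)
     (\<lambda>s t. Arrow (Src t) (\<lambda>X\<in>Obj (Cat M). Comp SET (Map s X) (Map t X)) (Tgt s))"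


section \<open>Models and the semantics functor\<close>

text \<open>
  A model structure \<open>\<xi>\<close> is coded as an element of the universe, as \<open>Mod(P, (C, \<Phi>))\<close> has to be a
  large category; \<open>vapp (vapp \<xi> X) p\<close> is \<open>\<xi>\<^sub>X(p)\<close>.
\<close>

locale is_model =
  fixes M :: "('v::universe, 'v) moncat" and C :: "('v, 'v) category"
    and \<Phi> :: "'v metamodel_data" and P :: "'v lax_data" and c :: 'v and \<xi> :: 'v
  assumes carrier_obj: "c \<in> Obj C"
    and structure_type: "\<xi> \<in> vPi (Obj (Cat M)) (\<lambda>X. vPi (lax_obj P X) (\<lambda>_. Phi_obj \<Phi> X c c))"
    and structure_natural: "u \<in> hom (Cat M) X' X \<Longrightarrow> p \<in> lax_obj P X \<Longrightarrow>
        vapp (vapp \<xi> X') (lax_arr P u p) =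
        Phi_arr \<Phi> u (Ident C c) (Ident C c) (vapp (vapp \<xi> X) p)"
    and structure_unit: "vapp (vapp \<xi> (Unit M)) (LUnitElt P) = PhiUnit \<Phi> c"
    and structure_mul: "X \<in> Obj (Cat M) \<Longrightarrow> Y \<in> Obj (Cat M) \<Longrightarrow>
        q \<in> lax_obj P Y \<Longrightarrow> p \<in> lax_obj P X \<Longrightarrow>
        vapp (vapp \<xi> (tensor_obj M Y X)) (LMul P X Y q p) =
        PhiMul \<Phi> X Y c c c (vapp (vapp \<xi> Y) q) (vapp (vapp \<xi> X) p)"

definition vtriple :: "'v::universe \<Rightarrow> 'v \<Rightarrow> 'v \<Rightarrow> 'v" where
  "vtriple s f t = vpair s (vpair f t)"

abbreviation (input) vsrc :: "'v::universe \<Rightarrow> 'v" where "vsrc m \<equiv> vfst m"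
abbreviation (input) vmid :: "'v::universe \<Rightarrow> 'v" where "vmid m \<equiv> vfst (vsnd m)"
abbreviation (input) vtgt :: "'v::universe \<Rightarrow> 'v" where "vtgt m \<equiv> vsnd (vsnd m)"

definition Mod :: "('v::universe, 'v) moncat \<Rightarrow> ('v, 'v) category \<Rightarrow> 'v metamodel_data \<Rightarrow>
    'v lax_data \<Rightarrow> ('v, 'v) category" where
  "Mod M C \<Phi> P = mk_category
     {vpair c \<xi> | c \<xi>. is_model M C \<Phi> P c \<xi>}
     {vtriple (vpair c \<xi>) f (vpair c' \<xi>') | c \<xi> f c' \<xi>'.
        is_model M C \<Phi> P c \<xi> \<and> is_model M C \<Phi> P c' \<xi>' \<and> f \<in> hom C c c' \<and>
        (\<forall>X\<in>Obj (Cat M). \<forall>p\<in>lax_obj P X.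
           Phi_arr \<Phi> (Ident (Cat M) X) (Ident C c) f (vapp (vapp \<xi> X) p) =
           Phi_arr \<Phi> (Ident (Cat M) X) f (Ident C c') (vapp (vapp \<xi>' X) p))}
     (\<lambda>m. vsrc m) (\<lambda>m. vtgt m)
     (\<lambda>s. vtriple s (Ident C (vfst s)) s)
     (\<lambda>n m. vtriple (vsrc m) (Comp C (vmid n) (vmid m)) (vtgt n))"

definition Sem_obj :: "('v::universe, 'v) moncat \<Rightarrow> ('v, 'v) category \<Rightarrow> 'v metamodel_data \<Rightarrow>
    'v lax_data \<Rightarrow> 'v cat_arrow" where
  "Sem_obj M C \<Phi> P =
     Arrow (Mod M C \<Phi> P) (mk_func (Mod M C \<Phi> P) (\<lambda>s. vfst s) (\<lambda>m. vmid m)) C"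

text \<open>For \<open>t : Q \<rightarrow> P\<close> in \<open>Th M\<close>, the model \<open>(c, \<xi>)\<close> of \<open>P\<close> is sent to the model \<open>(c, \<xi> \<circ> t)\<close> of \<open>Q\<close>.\<close>

definition precomp_model :: "('v::universe, 'v) moncat \<Rightarrow> 'v lax_arrow \<Rightarrow> 'v \<Rightarrow> 'v" where
  "precomp_model M t s = vpair (vfst s)
     (vlam (Obj (Cat M)) (\<lambda>X. vlam (lax_obj (Src t) X)
        (\<lambda>q. vapp (vapp (vsnd s) X) (Map (Map t X) q))))"

definition Sem_arr :: "('v::universe, 'v) moncat \<Rightarrow> ('v, 'v) category \<Rightarrow> 'v metamodel_data \<Rightarrow>
    'v lax_arrow \<Rightarrow> ('v cat_arrow, 'v cat_arrow) arrow" where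
  "Sem_arr M C \<Phi> t =
     Arrow (Sem_obj M C \<Phi> (Tgt t))
       (Arrow (Mod M C \<Phi> (Tgt t))
          (mk_func (Mod M C \<Phi> (Tgt t)) (precomp_model M t)
             (\<lambda>m. vtriple (precomp_model M t (vsrc m)) (vmid m) (precomp_model M t (vtgt m))))
          (Mod M C \<Phi> (Src t)))
       (Sem_obj M C \<Phi> (Src t))"

definition Sem :: "('v::universe, 'v) moncat \<Rightarrow> ('v, 'v) category \<Rightarrow> 'v metamodel_data \<Rightarrow>
    ('v lax_data, 'v lax_arrow, 'v cat_arrow, ('v cat_arrow, 'v cat_arrow) arrow) func" where
  "Sem M C \<Phi> = mk_func (opp (Th M)) (Sem_obj M C \<Phi>) (Sem_arr M C \<Phi>)"


section \<open>The structure functor\<close>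

text \<open>The functor \<open>\<Phi>\<^sub>X(V-, V-) : A\<^sup>o\<^sup>p \<times> A \<rightarrow> SET\<close> for \<open>V : A \<rightarrow> C\<close>.\<close>

definition Phi_along :: "('v::universe, 'v) moncat \<Rightarrow> 'v metamodel_data \<Rightarrow> 'v cat_arrow \<Rightarrow> 'v \<Rightarrow>
    ('v \<times> 'v, 'v \<times> 'v, 'v, 'v set_arrow) func" where
  "Phi_along M \<Phi> V X = mk_func (opp (Src V) \<times>\<^sub>C Src V)
     (\<lambda>(a, b). OMap (Phi \<Phi>) (X, OMap (Map V) a, OMap (Map V) b))
     (\<lambda>(f, g). AMap (Phi \<Phi>) (Ident (Cat M) X, AMap (Map V) f, AMap (Map V) g))"

definition Str_end :: "('v::universe, 'v) moncat \<Rightarrow> 'v metamodel_data \<Rightarrow> 'v cat_arrow \<Rightarrow> 'v \<Rightarrow> 'v" where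
  "Str_end M \<Phi> V X = end_SET (Src V) (Phi_along M \<Phi> V X)"

definition Str_obj :: "('v::universe, 'v) moncat \<Rightarrow> ('v, 'v) category \<Rightarrow> 'v metamodel_data \<Rightarrow>
    'v cat_arrow \<Rightarrow> 'v lax_data" where
  "Str_obj M C \<Phi> V =
     \<lparr>LFun = mk_func (opp (Cat M)) (Str_end M \<Phi> V)
        (\<lambda>u. Arrow (Str_end M \<Phi> V (Cod (Cat M) u))
           (\<lambda>x\<in>elts (Str_end M \<Phi> V (Cod (Cat M) u)).
              vlam (Obj (Src V)) (\<lambda>a. Phi_arr \<Phi> u (Ident C (OMap (Map V) a))
                                        (Ident C (OMap (Map V) a)) (vapp x a)))
           (Str_end M \<Phi> V (Dom (Cat M) u))),
      LUnitElt = vlam (Obj (Src V)) (\<lambda>a. PhiUnit \<Phi> (OMap (Map V) a)),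
      LMul = (\<lambda>X\<in>Obj (Cat M). \<lambda>Y\<in>Obj (Cat M).
                \<lambda>y\<in>elts (Str_end M \<Phi> V Y). \<lambda>x\<in>elts (Str_end M \<Phi> V X).
                  vlam (Obj (Src V)) (\<lambda>a. PhiMul \<Phi> X Y (OMap (Map V) a) (OMap (Map V) a)
                                            (OMap (Map V) a) (vapp y a) (vapp x a)))\<rparr>"

text \<open>
  \<open>F : V \<rightarrow> V'\<close> in the slice is sent to the reindexing map \<open>Str V' \<rightarrow> Str V\<close> in \<open>Th M\<close>,
  which is an arrow \<open>Str V \<rightarrow> Str V'\<close> of the opposite category.
\<close>

definition Str_arr :: "('v::universe, 'v) moncat \<Rightarrow> ('v, 'v) category \<Rightarrow> 'v metamodel_data \<Rightarrow>
    ('v cat_arrow, 'v cat_arrow) arrow \<Rightarrow> 'v lax_arrow" where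
  "Str_arr M C \<Phi> F =
     Arrow (Str_obj M C \<Phi> (Tgt F))
       (\<lambda>X\<in>Obj (Cat M). Arrow (Str_end M \<Phi> (Tgt F) X)
          (\<lambda>x\<in>elts (Str_end M \<Phi> (Tgt F) X).
             vlam (Obj (Src (Src F))) (\<lambda>a. vapp x (OMap (Map (Map F)) a)))
          (Str_end M \<Phi> (Src F) X))
       (Str_obj M C \<Phi> (Src F))"

definition Str :: "('v::universe, 'v) moncat \<Rightarrow> ('v, 'v) category \<Rightarrow> 'v metamodel_data \<Rightarrow>
    ('v cat_arrow, ('v cat_arrow, 'v cat_arrow) arrow, 'v lax_data, 'v lax_arrow) func" where
  "Str M C \<Phi> = mk_func (slice CAT C) (Str_obj M C \<Phi>) (Str_arr M C \<Phi>)"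

end

theory Submission
  imports Defs
begin

text \<open>
  An arrow \<open>P \<rightarrow> Str V\<close> of theories and an arrow \<open>V \<rightarrow> Sem P\<close> over \<open>C\<close> amount to the same data:
  elements \<open>g X p a\<close> of \<open>\<Phi>\<^sub>X(V a, V a)\<close>, for \<open>p\<close> in \<open>P(X)\<close> and \<open>a\<close> in the domain of \<open>V\<close>, that form
  a model of \<open>P\<close> in \<open>V a\<close> for fixed \<open>a\<close> and an element of the end \<open>\<integral>\<^sub>a \<Phi>\<^sub>X(V a, V a)\<close> for fixed \<open>X\<close>
  and \<open>p\<close>. The end condition along \<open>f : a \<rightarrow> b\<close> says exactly that \<open>V f\<close> is a morphism between the
  models at \<open>a\<close> and \<open>b\<close>. Since arrows on either side are determined by their families, naturality
  and functoriality are checked on families.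
\<close>

section \<open>Sets and functions inside the universe\<close>

text \<open>The arrow parts of both functors are themselves such families, the tautological ones:
  \<open>Sem_arr\<close> at \<open>t\<close> comes from the family that evaluates a model of the
  target theory at the image of \<open>q\<close> under \<open>t\<close>, and \<open>Str_arr\<close>
  at \<open>F\<close> from the one that evaluates an element of an end at the image of
  \<open>a\<close> under \<open>F\<close>. So the typing of both reduces to the two lemmas that turn
  families into arrows. In a composite, \<open>F\<close> moves the index \<open>a\<close> and a
  theory arrow moves the argument \<open>p\<close>; the two reindexings do not interact, which is
  why naturality of the bijection is immediate on families. The content beyond this lies in three
  places. Ends must be closed under multiplication, which takes extranaturality in the middle
  variable. Morphisms of models must compose, which takes the interchange of the two
  \<open>C\<close> variables of \<Phi>. And models, which contain functions, must form a large
  category; functions are therefore graphs inside the universe, and sets of them are bounded by a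
  power set.\<close>

lemma large_elts [simp]: "large (elts x)"
  by (simp add: large_def)

lemma elts_vset [simp]: "large A \<Longrightarrow> elts (vset A) = A"
  by (simp add: large_def vset_def f_inv_into_f)

lemma vset_eq_iff: "large A \<Longrightarrow> large B \<Longrightarrow> vset A = vset B \<longleftrightarrow> A = B"
  by (metis elts_vset)

lemma large_subset: "large B \<Longrightarrow> A \<subseteq> B \<Longrightarrow> large A"
  unfolding large_def using subset_closed by blast

lemma large_doubleton [simp]: "large {x, y}"
  by (simp add: large_def pair_closed)

lemma large_singleton [simp]: "large {x}"
  using large_doubleton[of x x] by simp

text \<open>The axiom \<open>union_closed\<close> indexes by elements of the universe;
  \<open>vset\<close> converts the HOL sets \<open>F i\<close> into such elements.\<close>

lemma large_UN:
  fixes F :: "'v::universe \<Rightarrow> 'v set"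
  assumes "large A" and "\<And>i. i \<in> A \<Longrightarrow> large (F i)"
  shows "large (\<Union>i\<in>A. F i)"
proof -
  obtain x where x: "A = elts x" using assms(1) by (auto simp: large_def)
  have "(\<Union>i\<in>A. F i) = (\<Union>i\<in>elts x. elts (vset (F i)))"
    using assms(2) x by simp
  then show ?thesis using union_closed[where x = x and f = "\<lambda>i. vset (F i)"]
      by (simp add: large_def)
qed

text \<open>Replacement, obtained as a union of singletons.\<close>

lemma large_image:
  fixes f :: "'v::universe \<Rightarrow> 'v"
  shows "large A \<Longrightarrow> large (f ` A)"
proof -
  assume "large A"
  then have "large (\<Union>i\<in>A. {f i})" by (rule large_UN) simp
  moreover have "(\<Union>i\<in>A. {f i}) = f ` A" by auto
  ultimately show ?thesis by simp
qed

text \<open>Kuratowski pairs are built from doubletons only. These are always large, so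
  \<open>vset\<close> is injective on them.\<close>

lemma vpair_inject [simp]: "vpair a b = vpair a' b' \<longleftrightarrow> a = a' \<and> b = b'"
  by (auto simp: vpair_def vset_eq_iff doubleton_eq_iff)

lemma vfst_vpair [simp]: "vfst (vpair a b) = a"
  and vsnd_vpair [simp]: "vsnd (vpair a b) = b"
  by (auto simp: vfst_def vsnd_def)

lemma large_vpairs:
  assumes "large A" and "\<And>a. a \<in> A \<Longrightarrow> large (B a)"
  shows "large {vpair a b | a b. a \<in> A \<and> b \<in> B a}"
proof -
  have "{vpair a b | a b. a \<in> A \<and> b \<in> B a} = (\<Union>a\<in>A. vpair a ` B a)" by auto
  then show ?thesis using assms by (simp add: large_UN large_image)
qed

text \<open>Largeness of \<open>D\<close> makes the graph large, so that \<open>vset\<close> really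
  codes it.\<close>

lemma vapp_vlam [simp]: "large D \<Longrightarrow> a \<in> D \<Longrightarrow> vapp (vlam D f) a = f a"
  by (auto simp: vapp_def vlam_def large_image)

lemma vlam_cong: "(\<And>a. a \<in> D \<Longrightarrow> f a = g a) \<Longrightarrow> vlam D f = vlam D g"
  by (auto simp: vlam_def intro!: arg_cong[where f = vset])

lemma vlam_in_vPi: "(\<And>a. a \<in> D \<Longrightarrow> f a \<in> F a) \<Longrightarrow> vlam D f \<in> vPi D F"
  by (auto simp: vPi_def)

lemma vapp_in: "large D \<Longrightarrow> x \<in> vPi D F \<Longrightarrow> a \<in> D \<Longrightarrow> vapp x a \<in> F a"
  by (auto simp: vPi_def)

lemma vPi_eqI:
  assumes "large D" "x \<in> vPi D F" "y \<in> vPi D G" "\<And>a. a \<in> D \<Longrightarrow> vapp x a = vapp y a"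
  shows "x = y"
  using assms by (auto simp: vPi_def intro!: vlam_cong)

lemma vPi_cong: "(\<And>a. a \<in> D \<Longrightarrow> F a = G a) \<Longrightarrow> vPi D F = vPi D G"
  by (auto simp: vPi_def)

text \<open>A dependent function is, as a graph, a subset of the large set of all pairs, so the
  product lies inside a power set.\<close>

lemma large_vPi:
  assumes "large D" and "\<And>a. a \<in> D \<Longrightarrow> large (F a)"
  shows "large (vPi D F)"
proof -
  let ?S = "{vpair a b | a b. a \<in> D \<and> b \<in> F a}"
  have S: "large ?S" using assms by (rule large_vpairs)
  have "large {y. elts y \<subseteq> ?S}"
    using power_closed[of "vset ?S"] S by (simp add: large_def)
  moreover have "vPi D F \<subseteq> {y. elts y \<subseteq> ?S}"
    using assms(1) by (auto simp: vPi_def vlam_def large_image)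
  ultimately show ?thesis by (rule large_subset)
qed

lemma vtriple_inject [simp]: "vtriple s f t = vtriple s' f' t' \<longleftrightarrow> s = s' \<and> f = f' \<and> t = t'"
  by (simp add: vtriple_def)

lemma vtriple_proj [simp]:
  "vfst (vtriple s f t) = s" "vfst (vsnd (vtriple s f t)) = f" "vsnd (vsnd (vtriple s f t)) = t"
  by (simp_all add: vtriple_def)


section \<open>Constructions on categories\<close>

lemma mk_category_simps [simp]:
  "Obj (mk_category Ob Ar d c i k) = Ob"
  "Arr (mk_category Ob Ar d c i k) = Ar"
  "f \<in> Ar \<Longrightarrow> Dom (mk_category Ob Ar d c i k) f = d f"
  "f \<in> Ar \<Longrightarrow> Cod (mk_category Ob Ar d c i k) f = c f"
  "a \<in> Ob \<Longrightarrow> Ident (mk_category Ob Ar d c i k) a = i a"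
  "f \<in> Ar \<Longrightarrow> g \<in> Ar \<Longrightarrow> d g = c f \<Longrightarrow> Comp (mk_category Ob Ar d c i k) g f = k g f"
  by (simp_all add: mk_category_def)

lemma in_hom_mk_category:
  "f \<in> hom (mk_category Ob Ar d c i k) a b \<longleftrightarrow> f \<in> Ar \<and> d f = a \<and> c f = b"
  by (auto simp: hom_def)

text \<open>The extensionality axioms hold by construction of \<open>mk_category\<close>, so only
  laws of the raw operations remain. Under \<open>goal_cases\<close> they are numbered: 1 and 2
  domains and codomains, 3 to 5 identities, 6 closure under composition, 7 and 8 unit laws, 9
  associativity.\<close>

lemma category_mk_category:
  assumes "\<And>f. f \<in> Ar \<Longrightarrow> d f \<in> Ob" "\<And>f. f \<in> Ar \<Longrightarrow> c f \<in> Ob"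
    and i: "\<And>a. a \<in> Ob \<Longrightarrow> i a \<in> Ar" "\<And>a. a \<in> Ob \<Longrightarrow> d (i a) = a" "\<And>a. a \<in> Ob \<Longrightarrow> c (i a) = a"
    and k: "\<And>f g. f \<in> Ar \<Longrightarrow> g \<in> Ar \<Longrightarrow> d g = c f \<Longrightarrow> k g f \<in> Ar \<and> d (k g f) = d f \<and> c (k g f) = c g"
    and "\<And>f. f \<in> Ar \<Longrightarrow> k (i (c f)) f = f" "\<And>f. f \<in> Ar \<Longrightarrow> k f (i (d f)) = f"
    and "\<And>f g h. f \<in> Ar \<Longrightarrow> g \<in> Ar \<Longrightarrow> h \<in> Ar \<Longrightarrow> d g = c f \<Longrightarrow> d h = c g \<Longrightarrow>
           k (k h g) f = k h (k g f)"
  shows "category (mk_category Ob Ar d c i k)"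
proof
  show "Dom (mk_category Ob Ar d c i k) \<in> extensional (Arr (mk_category Ob Ar d c i k))"
    "Cod (mk_category Ob Ar d c i k) \<in> extensional (Arr (mk_category Ob Ar d c i k))"
    "Ident (mk_category Ob Ar d c i k) \<in> extensional (Obj (mk_category Ob Ar d c i k))"
    by (simp_all add: mk_category_def)
next
  fix f g
  assume "\<not> (f \<in> Arr (mk_category Ob Ar d c i k) \<and> g \<in> Arr (mk_category Ob Ar d c i k) \<and>
    Dom (mk_category Ob Ar d c i k) g = Cod (mk_category Ob Ar d c i k) f)"
  then show "Comp (mk_category Ob Ar d c i k) g f = undefined"
    by (auto simp: mk_category_def)
qed (use assms in \<open>auto simp: in_hom_mk_category\<close>)

lemma (in category) hom_obj: "f \<in> hom C a b \<Longrightarrow> a \<in> Obj C \<and> b \<in> Obj C"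
  using dom_obj cod_obj by (auto simp: hom_def)

lemma (in category) arr_in_hom: "f \<in> Arr C \<Longrightarrow> f \<in> hom C (Dom C f) (Cod C f)"
  by (simp add: hom_def)

lemma (in category) arr_ident_simps:
  "f \<in> Arr C \<Longrightarrow> Comp C (Ident C (Cod C f)) f = f"
  "f \<in> Arr C \<Longrightarrow> Comp C f (Ident C (Dom C f)) = f"
  using comp_ident_left[OF arr_in_hom] comp_ident_right[OF arr_in_hom] by auto

section \<open>Opposite and product categories\<close>

lemma opp_simps [simp]:
  "Obj (opp C) = Obj C" "Arr (opp C) = Arr C"
  "f \<in> Arr C \<Longrightarrow> Dom (opp C) f = Cod C f" "f \<in> Arr C \<Longrightarrow> Cod (opp C) f = Dom C f"
  "a \<in> Obj C \<Longrightarrow> Ident (opp C) a = Ident C a"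
  by (simp_all add: opp_def)

lemma in_hom_opp [simp]: "f \<in> hom (opp C) a b \<longleftrightarrow> f \<in> hom C b a"
  by (auto simp: opp_def hom_def)

text \<open>On pairs that are not composable both sides are \<open>undefined\<close>, by
  \<open>comp_ext\<close>; hence a rewrite rule without side conditions.\<close>

lemma (in category) Comp_opp [simp]: "Comp (opp C) g f = Comp C f g"
  using comp_ext[of g f] by (auto simp: opp_def mk_category_def)

lemma category_opp:
  assumes "category C"
  shows "category (opp C)"
proof -
  interpret category C by fact
  show ?thesis unfolding opp_def
    by (rule category_mk_category)
      (use dom_obj cod_obj ident_hom comp_hom comp_ident_left comp_ident_right comp_assoc
        in \<open>auto simp: hom_def\<close>)
qed

lemma in_hom_prod [simp]:
  "(f, g) \<in> hom (A \<times>\<^sub>C B) (a, b) (a', b') \<longleftrightarrow> f \<in> hom A a a' \<and> g \<in> hom B b b'"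
  by (auto simp: prod_cat_def hom_def)

lemma prod_cat_simps [simp]:
  "Obj (A \<times>\<^sub>C B) = Obj A \<times> Obj B" "Arr (A \<times>\<^sub>C B) = Arr A \<times> Arr B"
  "a \<in> Obj A \<Longrightarrow> b \<in> Obj B \<Longrightarrow> Ident (A \<times>\<^sub>C B) (a, b) = (Ident A a, Ident B b)"
  by (simp_all add: prod_cat_def)

lemma Comp_prod:
  "f \<in> hom A a b \<Longrightarrow> g \<in> hom A b c \<Longrightarrow> f' \<in> hom B a' b' \<Longrightarrow> g' \<in> hom B b' c' \<Longrightarrow>
    Comp (A \<times>\<^sub>C B) (g, g') (f, f') = (Comp A g f, Comp B g' f')"
  by (simp add: prod_cat_def hom_def)

section \<open>Functors, their composition and equality\<close>

lemma mk_func_simps [simp]: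
  "a \<in> Obj A \<Longrightarrow> OMap (mk_func A fo fa) a = fo a"
  "f \<in> Arr A \<Longrightarrow> AMap (mk_func A fo fa) f = fa f"
  "OMap (mk_func A fo fa) \<in> extensional (Obj A)"
  "AMap (mk_func A fo fa) \<in> extensional (Arr A)"
  by (simp_all add: mk_func_def)

lemma AMap_mk_func [simp]: "f \<in> hom A a b \<Longrightarrow> AMap (mk_func A fo fa) f = fa f"
  by (simp add: mk_func_def hom_def)

lemma func_eqI:
  assumes "OMap F \<in> extensional (Obj A)" "AMap F \<in> extensional (Arr A)"
    and "OMap G \<in> extensional (Obj A)" "AMap G \<in> extensional (Arr A)"
    and "\<And>a. a \<in> Obj A \<Longrightarrow> OMap F a = OMap G a" "\<And>f. f \<in> Arr A \<Longrightarrow> AMap F f = AMap G f"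
  shows "F = (G :: ('o, 'm, 'p, 'n) func)"
  using assms by (intro func.equality) (auto intro: extensionalityI)

lemma is_functor_mk_func:
  assumes "category A" "category B"
    and "\<And>a. a \<in> Obj A \<Longrightarrow> fo a \<in> Obj B"
    and "\<And>f a b. f \<in> hom A a b \<Longrightarrow> fa f \<in> hom B (fo a) (fo b)"
    and "\<And>a. a \<in> Obj A \<Longrightarrow> fa (Ident A a) = Ident B (fo a)"
    and "\<And>f g a b c. f \<in> hom A a b \<Longrightarrow> g \<in> hom A b c \<Longrightarrow> fa (Comp A g f) = Comp B (fa g) (fa f)"
  shows "is_functor A B (mk_func A fo fa)"
proof -
  interpret A: category A by fact
  interpret B: category B by fact
  show ?thesis
  proof
    fix f a b assume f: "f \<in> hom A a b"
    then show "AMap (mk_func A fo fa) f \<in> hom B (OMap (mk_func A fo fa) a)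
        (OMap (mk_func A fo fa) b)"
      using A.hom_obj[OF f] assms(4) by simp
  next
    fix a assume a: "a \<in> Obj A"
    then show "AMap (mk_func A fo fa) (Ident A a) = Ident B (OMap (mk_func A fo fa) a)"
      using A.ident_hom[OF a] assms(5) by simp
  next
    fix f g a b c assume f: "f \<in> hom A a b" and g: "g \<in> hom A b c"
    then show "AMap (mk_func A fo fa) (Comp A g f) =
        Comp B (AMap (mk_func A fo fa) g) (AMap (mk_func A fo fa) f)"
      using A.comp_hom[OF f g] assms(6) by simp
  qed (use assms(3) in auto)
qed

lemma is_functor_id: "category A \<Longrightarrow> is_functor A A (id_func A)"
  unfolding id_func_def by (rule is_functor_mk_func) auto

lemma is_functor_comp:
  assumes "is_functor A B F" "is_functor B D G"
  shows "is_functor A D (comp_func A G F)"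
proof -
  interpret F: is_functor A B F by fact
  interpret G: is_functor B D G by fact
  show ?thesis unfolding comp_func_def
    by (rule is_functor_mk_func)
      (auto intro: F.A.category_axioms G.B.category_axioms simp: F.omap_obj G.omap_obj F.amap_ident
        G.amap_ident
        F.amap_comp G.amap_comp[OF F.amap_hom F.amap_hom] intro: F.amap_hom G.amap_hom)
qed

lemma comp_func_simps [simp]:
  "a \<in> Obj A \<Longrightarrow> OMap (comp_func A G F) a = OMap G (OMap F a)"
  "f \<in> Arr A \<Longrightarrow> AMap (comp_func A G F) f = AMap G (AMap F f)"
  "f \<in> hom A a b \<Longrightarrow> AMap (comp_func A G F) f = AMap G (AMap F f)"
  by (simp_all add: comp_func_def)

lemma id_func_simps [simp]:
  "a \<in> Obj A \<Longrightarrow> OMap (id_func A) a = a"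
  "f \<in> Arr A \<Longrightarrow> AMap (id_func A) f = f"
  "f \<in> hom A a b \<Longrightarrow> AMap (id_func A) f = f"
  by (simp_all add: id_func_def)

lemma func_eq_mk_func:
  assumes "OMap F \<in> extensional (Obj A)" "AMap F \<in> extensional (Arr A)"
    and "\<And>a. a \<in> Obj A \<Longrightarrow> OMap F a = fo a" "\<And>f. f \<in> Arr A \<Longrightarrow> AMap F f = fa f"
  shows "F = mk_func A fo fa"
  using assms by (intro func_eqI[of _ A]) auto

lemma (in is_functor) comp_func_id_right: "comp_func A F (id_func A) = F"
  unfolding comp_func_def by (rule func_eq_mk_func[symmetric]) (auto simp: omap_ext amap_ext)

lemma (in is_functor) amap_arr: "f \<in> Arr A \<Longrightarrow> AMap F f \<in> Arr B"
  using amap_hom[OF A.arr_in_hom] by (simp add: hom_def)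

lemma (in is_functor) comp_func_id_left: "comp_func A (id_func B) F = F"
  unfolding comp_func_def
  by (rule func_eq_mk_func[symmetric]) (auto simp: omap_ext amap_ext omap_obj amap_arr)

lemma comp_func_assoc:
  assumes "is_functor A B F" "is_functor B D G"
  shows "comp_func A (comp_func B H G) F = comp_func A H (comp_func A G F)"
proof -
  interpret F: is_functor A B F by fact
  interpret G: is_functor B D G by fact
  show ?thesis
    by (rule func_eqI[of _ A]) (auto simp: comp_func_def F.omap_obj F.amap_arr)
qed

lemma arrow_eqI: "Src f = Src g \<Longrightarrow> Map f = Map g \<Longrightarrow> Tgt f = Tgt g \<Longrightarrow> f = g"
  by (rule arrow.expand) simp

section \<open>The category of sets of the universe\<close>

lemma in_hom_SET: "f \<in> hom SET x y \<longleftrightarrow> Src f = x \<and> Tgt f = y \<and> Map f \<in> elts x \<rightarrow>\<^sub>E elts y"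
  by (auto simp: SET_def in_hom_mk_category)

lemma hom_SET_eqI:
  assumes "f \<in> hom SET x y" "g \<in> hom SET x y" "\<And>a. a \<in> elts x \<Longrightarrow> Map f a = Map g a"
  shows "f = g"
  using assms by (intro arrow_eqI) (auto simp: in_hom_SET intro: PiE_ext)

lemma category_SET: "category SET"
  unfolding SET_def
  by (rule category_mk_category)
    (auto simp: compose_def restrict_def PiE_def extensional_def Pi_def fun_eq_iff intro!:
      arrow_eqI)

lemma Obj_SET [simp]: "Obj SET = UNIV"
  by (simp add: SET_def)

lemma Ident_SET: "Ident SET x = Arrow x (\<lambda>a\<in>elts x. a) x"
  by (simp add: SET_def)

lemma Comp_SET:
  "f \<in> hom SET x y \<Longrightarrow> g \<in> hom SET y z \<Longrightarrow>
    Comp SET g f = Arrow x (compose (elts x) (Map g) (Map f)) z"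
  unfolding in_hom_SET unfolding SET_def by auto

lemma Map_Ident_SET [simp]: "a \<in> elts x \<Longrightarrow> Map (Ident SET x) a = a"
  by (simp add: Ident_SET)

lemma Map_Comp_SET:
  "f \<in> hom SET x y \<Longrightarrow> g \<in> hom SET y z \<Longrightarrow> a \<in> elts x \<Longrightarrow>
    Map (Comp SET g f) a = Map g (Map f a)"
  by (simp add: Comp_SET compose_def)

lemma Map_in_SET: "f \<in> hom SET x y \<Longrightarrow> a \<in> elts x \<Longrightarrow> Map f a \<in> elts y"
  by (auto simp: in_hom_SET)

section \<open>The category of large categories and its slices\<close>

lemma Arr_CAT: "F \<in> Arr CAT \<longleftrightarrow>
    large_category (Src F) \<and> large_category (Tgt F) \<and> is_functor (Src F) (Tgt F) (Map F)"
  by (simp add: CAT_def)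

lemma in_hom_CAT: "F \<in> hom CAT A B \<longleftrightarrow> Src F = A \<and> Tgt F = B \<and>
    large_category A \<and> large_category B \<and> is_functor A B (Map F)"
  by (auto simp: CAT_def in_hom_mk_category)

lemma CAT_simps [simp]:
  "F \<in> Arr CAT \<Longrightarrow> Dom CAT F = Src F" "F \<in> Arr CAT \<Longrightarrow> Cod CAT F = Tgt F"
  "large_category A \<Longrightarrow> Ident CAT A = Arrow A (id_func A) A"
  by (simp_all add: CAT_def)

lemma Comp_CAT:
  "F \<in> Arr CAT \<Longrightarrow> G \<in> Arr CAT \<Longrightarrow> Src G = Tgt F \<Longrightarrow>
    Comp CAT G F = Arrow (Src F) (comp_func (Src F) (Map G) (Map F)) (Tgt G)"
  by (simp add: CAT_def)

lemma category_CAT: "category CAT"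
  unfolding CAT_def
  by (rule category_mk_category)
    (auto intro!: arrow_eqI is_functor_id is_functor_comp comp_func_assoc
      is_functor.comp_func_id_left is_functor.comp_func_id_right
      intro: large_category.axioms(1) is_functor_comp)

lemma category_slice:
  assumes "category K"
  shows "category (slice K c)"
proof -
  interpret category K by fact
  show ?thesis unfolding slice_def
  proof (rule category_mk_category, goal_cases)
    \<comment> \<open>Closure under composition: two commuting triangles over \<open>c\<close> are
      pasted by associativity in \<open>K\<close>.\<close>
    case (6 f g)
    then show ?case
      using comp_hom[of "Map f" _ _ "Map g"] comp_assoc[of "Map f" _ _ "Map g" _ "Tgt g"]
      by (auto simp: hom_def)
  next
    case (9 f g h)
    then show ?case by (auto intro!: arrow_eqI comp_assoc)
  next
    case (7 f)
    then show ?case using arr_ident_simps[of "Map f"] by (auto intro!: arrow_eqI simp: hom_def)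
  next
    case (8 f)
    then show ?case using arr_ident_simps[of "Map f"] by (auto intro!: arrow_eqI simp: hom_def)
  qed (use arr_ident_simps ident_hom dom_obj in \<open>auto intro!: arrow_eqI simp: hom_def\<close>)
qed

lemma Arrow_eq_iff: "Arrow a f b = g \<longleftrightarrow> a = Src g \<and> f = Map g \<and> b = Tgt g"
  by (cases g) auto

lemma Obj_slice_CAT: "V \<in> Obj (slice CAT C) \<longleftrightarrow>
    large_category (Src V) \<and> large_category C \<and> Tgt V = C \<and> is_functor (Src V) C (Map V)"
  by (auto simp: slice_def Arr_CAT)

text \<open>Arrows are wrapped twice: \<open>Map F\<close> is an arrow of \<open>CAT\<close> and
  \<open>Map (Map F)\<close> is the functor itself. The last conjunct is the triangle over
  \<open>C\<close>, now an equation between functors.\<close>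

lemma in_hom_slice_CAT: "F \<in> hom (slice CAT C) V W \<longleftrightarrow>
    V \<in> Obj (slice CAT C) \<and> W \<in> Obj (slice CAT C) \<and> Src F = V \<and> Tgt F = W \<and>
    Src (Map F) = Src V \<and> Tgt (Map F) = Src W \<and> is_functor (Src V) (Src W) (Map (Map F)) \<and>
    comp_func (Src V) (Map W) (Map (Map F)) = Map V"
proof (cases "V \<in> Obj (slice CAT C) \<and> W \<in> Obj (slice CAT C)")
  case True
  then have "V \<in> Arr CAT" "W \<in> Arr CAT" "Tgt V = C" "Tgt W = C"
    by (auto simp: Obj_slice_CAT Arr_CAT)
  with True show ?thesis
    by (auto simp: slice_def in_hom_mk_category in_hom_CAT Comp_CAT Arr_CAT
        Arrow_eq_iff)
next
  case False
  then show ?thesis by (auto simp: slice_def in_hom_mk_category)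
qed

lemma Comp_slice:
  "f \<in> Arr (slice K c) \<Longrightarrow> g \<in> Arr (slice K c) \<Longrightarrow> Src g = Tgt f \<Longrightarrow>
    Comp (slice K c) g f = Arrow (Src f) (Comp K (Map g) (Map f)) (Tgt g)"
  by (simp add: slice_def)

lemma Comp_slice_CAT:
  assumes "F \<in> hom (slice CAT C) U V" "G \<in> hom (slice CAT C) V W"
  shows "Comp (slice CAT C) G F =
    Arrow U (Arrow (Src U) (comp_func (Src U) (Map (Map G)) (Map (Map F))) (Src W)) W"
proof -
  have "F \<in> Arr (slice CAT C)" "G \<in> Arr (slice CAT C)" using assms by (auto simp: hom_def)
  moreover have "Map F \<in> Arr CAT" "Map G \<in> Arr CAT"
    using assms by (auto simp: in_hom_slice_CAT Arr_CAT Obj_slice_CAT)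
  ultimately show ?thesis
    using assms unfolding in_hom_slice_CAT by (simp add: Comp_slice Comp_CAT)
qed

lemma Ident_slice_CAT:
  "V \<in> Obj (slice CAT C) \<Longrightarrow>
    Ident (slice CAT C) V = Arrow V (Arrow (Src V) (id_func (Src V)) (Src V)) V"
  by (auto simp: slice_def Arr_CAT)

lemma category_slice_CAT: "category (slice CAT C)"
  by (intro category_slice category_CAT)


section \<open>Theories\<close>

context lax_monoidal_functor
begin

lemma lax_arr_in: "u \<in> hom (Cat M) X' X \<Longrightarrow> x \<in> lax_obj P X \<Longrightarrow> lax_arr P u x \<in> lax_obj P X'"
  using Map_in_SET[OF amap_hom, of u X X'] by (simp add: lax_arr_def lax_obj_def)

lemma lax_mul_in:
  "X \<in> Obj (Cat M) \<Longrightarrow> Y \<in> Obj (Cat M) \<Longrightarrow> y \<in> lax_obj P Y \<Longrightarrow> x \<in> lax_obj P X \<Longrightarrow>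
    LMul P X Y y x \<in> lax_obj P (tensor_obj M Y X)"
  using lax_mul_type by (blast dest: PiE_mem)

end

context monoidal_nat_trans
begin

lemma map_in: "X \<in> Obj (Cat M) \<Longrightarrow> p \<in> lax_obj P X \<Longrightarrow> Map (t X) p \<in> lax_obj Q X"
  using Map_in_SET[OF component, of X] by (simp add: lax_obj_def)

lemma map_natural:
  assumes u: "u \<in> hom (Cat M) X' X" and p: "p \<in> lax_obj P X"
  shows "Map (t X') (lax_arr P u p) = lax_arr Q u (Map (t X) p)"
proof -
  have u': "u \<in> hom (opp (Cat M)) X X'" using u by simp
  have X: "X \<in> Obj (opp (Cat M))" "X' \<in> Obj (opp (Cat M))" using P.M.hom_obj[OF u] by auto
  have "Map (Comp SET (t X') (AMap (LFun P) u)) p = Map (Comp SET (AMap (LFun Q) u) (t X)) p"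
    using natural[OF u'] by simp
  then show ?thesis
    using p Map_Comp_SET[OF P.amap_hom[OF u'] component[OF X(2)]]
      Map_Comp_SET[OF component[OF X(1)] Q.amap_hom[OF u']]
    by (simp add: lax_obj_def lax_arr_def)
qed

end

text \<open>Naturality enters elementwise, which suits components that are given by explicit
  functions; the equation between composites in \<open>SET\<close> is recovered by
  extensionality.\<close>

lemma monoidal_nat_transI:
  assumes "lax_monoidal_functor M P" "lax_monoidal_functor M Q"
    and comp: "\<And>X. X \<in> Obj (Cat M) \<Longrightarrow> t X \<in> hom SET (OMap (LFun P) X) (OMap (LFun Q) X)"
    and ext: "t \<in> extensional (Obj (Cat M))"
    and nat: "\<And>u X X' p. u \<in> hom (Cat M) X' X \<Longrightarrow> p \<in> lax_obj P X \<Longrightarrow>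
      Map (t X') (lax_arr P u p) = lax_arr Q u (Map (t X) p)"
    and unit: "Map (t (Unit M)) (LUnitElt P) = LUnitElt Q"
    and mul: "\<And>X Y y x. X \<in> Obj (Cat M) \<Longrightarrow> Y \<in> Obj (Cat M) \<Longrightarrow>
      y \<in> lax_obj P Y \<Longrightarrow> x \<in> lax_obj P X \<Longrightarrow>
      Map (t (tensor_obj M Y X)) (LMul P X Y y x) = LMul Q X Y (Map (t Y) y) (Map (t X) x)"
  shows "monoidal_nat_trans M P Q t"
proof -
  interpret P: lax_monoidal_functor M P by fact
  interpret Q: lax_monoidal_functor M Q by fact
  interpret S: category SET by (rule category_SET)
  show ?thesis
  proof
    fix u X X' assume u: "u \<in> hom (opp (Cat M)) X X'"
    have X: "X \<in> Obj (Cat M)" "X' \<in> Obj (Cat M)" using P.M.hom_obj u by auto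
    note C = P.amap_hom[OF u] comp[OF X(2)] comp[OF X(1)] Q.amap_hom[OF u]
    show "Comp SET (t X') (AMap (LFun P) u) = Comp SET (AMap (LFun Q) u) (t X)"
    proof (rule hom_SET_eqI[OF S.comp_hom[OF C(1,2)] S.comp_hom[OF C(3,4)]])
      fix p assume "p \<in> elts (OMap (LFun P) X)"
      then show "Map (Comp SET (t X') (AMap (LFun P) u)) p =
          Map (Comp SET (AMap (LFun Q) u) (t X)) p"
        using nat[of u X' X p] u Map_Comp_SET[OF C(1,2)] Map_Comp_SET[OF C(3,4)]
        by (simp add: lax_obj_def lax_arr_def)
    qed
  qed (use comp ext unit mul in auto)
qed

lemma Obj_Th [simp]: "P \<in> Obj (Th M) \<longleftrightarrow> lax_monoidal_functor M P"
  by (simp add: Th_def)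

lemma in_hom_Th:
  "t \<in> hom (Th M) P Q \<longleftrightarrow> Src t = P \<and> Tgt t = Q \<and> monoidal_nat_trans M P Q (Map t)"
  by (auto simp: Th_def in_hom_mk_category)

lemma hom_Th_eqI:
  assumes "s \<in> hom (Th M) P Q" "t \<in> hom (Th M) P Q"
    and "\<And>X p. X \<in> Obj (Cat M) \<Longrightarrow> p \<in> lax_obj P X \<Longrightarrow> Map (Map s X) p = Map (Map t X) p"
  shows "s = t"
proof -
  interpret s: monoidal_nat_trans M P Q "Map s" using assms by (simp add: in_hom_Th)
  interpret t: monoidal_nat_trans M P Q "Map t" using assms by (simp add: in_hom_Th)
  have "Map s = Map t"
  proof (rule extensionalityI[OF s.component_ext t.component_ext])
    fix X assume X: "X \<in> Obj (opp (Cat M))"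
    show "Map s X = Map t X"
      by (rule hom_SET_eqI[OF s.component[OF X] t.component[OF X]])
        (use X assms(3) in \<open>simp add: lax_obj_def\<close>)
  qed
  then show ?thesis using assms by (intro arrow_eqI) (auto simp: in_hom_Th)
qed

lemma Map_Ident_Th:
  "lax_monoidal_functor M P \<Longrightarrow> X \<in> Obj (Cat M) \<Longrightarrow> p \<in> lax_obj P X \<Longrightarrow>
    Map (Map (Ident (Th M) P) X) p = p"
  by (simp add: Th_def lax_obj_def)

lemma Map_Comp_Th:
  assumes s: "s \<in> hom (Th M) Q R" and t: "t \<in> hom (Th M) P Q"
    and X: "X \<in> Obj (Cat M)" and p: "p \<in> lax_obj P X"
  shows "Map (Map (Comp (Th M) s t) X) p = Map (Map s X) (Map (Map t X) p)"
proof -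
  interpret s: monoidal_nat_trans M Q R "Map s" using s by (simp add: in_hom_Th)
  interpret t: monoidal_nat_trans M P Q "Map t" using t by (simp add: in_hom_Th)
  have "s \<in> Arr (Th M)" "t \<in> Arr (Th M)" "Src s = Tgt t"
    using s t unfolding in_hom_Th by (auto simp: Th_def)
  then have "Map (Comp (Th M) s t) X = Comp SET (Map s X) (Map t X)"
    using X by (simp add: Th_def)
  then show ?thesis
    using p X Map_Comp_SET[OF t.component s.component, of X p] by (simp add: lax_obj_def)
qed

text \<open>Monoidality of \<open>M\<close> is part of \<open>lax_monoidal_functor\<close>, so every
  object or arrow of \<open>Th M\<close> provides it.\<close>

lemma category_Th: "category (Th M)"
proof -
  interpret S: category SET by (rule category_SET)
  have ext: "Map t = Map s" if "monoidal_nat_trans M P Q (Map t)" "monoidal_nat_trans M P Q (Map s)"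
    "\<And>X p. X \<in> Obj (Cat M) \<Longrightarrow> p \<in> lax_obj P X \<Longrightarrow> Map (Map t X) p = Map (Map s X) p"
    for P Q and s t :: "('a lax_data, 'a \<Rightarrow> ('a, 'a \<Rightarrow> 'a) arrow) arrow"
    using hom_Th_eqI[where t = "Arrow P (Map s) Q" and s = "Arrow P (Map t) Q"] that
    by (simp add: in_hom_Th)
  have id: "monoidal_nat_trans M P P (\<lambda>X\<in>Obj (Cat M). Ident SET (OMap (LFun P) X))"
    if "lax_monoidal_functor M P" for P
  proof -
    interpret P: lax_monoidal_functor M P by fact
    show ?thesis
    proof (rule monoidal_nat_transI[OF that that], goal_cases)
      case (1 X)
      then show ?case using S.ident_hom by simp
    next
      case (3 u X X' p)
      then show ?case using P.M.hom_obj[of u] P.lax_arr_in[of u] by (simp add: lax_obj_def)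
    next
      case 4
      then show ?case using P.M.unit_obj P.lax_unit_type by (simp add: lax_obj_def)
    next
      case (5 X Y y x)
      then show ?case using P.lax_mul_in[of X Y y x] P.M.tensor.omap_obj[of "(Y, X)"]
        by (simp add: lax_obj_def)
    qed simp
  qed
  have comp: "monoidal_nat_trans M P R (\<lambda>X\<in>Obj (Cat M). Comp SET (s X) (t X))"
    if "monoidal_nat_trans M P Q t" "monoidal_nat_trans M Q R s" for P Q R s t
  proof -
    interpret t: monoidal_nat_trans M P Q t by fact
    interpret s: monoidal_nat_trans M Q R s by fact
    have eq: "Map (Comp SET (s X) (t X)) p = Map (s X) (Map (t X) p)"
      if "X \<in> Obj (Cat M)" "p \<in> lax_obj P X" for X p
      using that Map_Comp_SET[OF t.component s.component, of X p] by (simp add: lax_obj_def)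
    show ?thesis
    proof (rule monoidal_nat_transI, goal_cases)
      case (3 X)
      then show ?case using S.comp_hom[OF t.component s.component, of X] by simp
    next
      case (5 u X X' p)
      then show ?case using t.P.M.hom_obj[of u] t.P.lax_arr_in[of u]
        by (simp add: eq t.map_natural s.map_natural t.map_in)
    next
      case 6
      then show ?case using t.P.M.unit_obj t.P.lax_unit_type
        by (simp add: eq t.preserves_unit s.preserves_unit)
    next
      case (7 X Y y x)
      then show ?case using t.P.lax_mul_in[of X Y y x] t.P.M.tensor.omap_obj[of "(Y, X)"]
        by (simp add: eq t.preserves_mul s.preserves_mul t.map_in)
    qed (simp_all add: t.P.lax_monoidal_functor_axioms s.Q.lax_monoidal_functor_axioms)
  qed
  \<comment> \<open>This reduces the unit and associativity laws of \<open>Th M\<close> to those of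
    \<open>SET\<close>, one component at a time.\<close>
  have eqI: "s = t" if "s \<in> {t. monoidal_nat_trans M (Src t) (Tgt t) (Map t)}"
    "t \<in> {t. monoidal_nat_trans M (Src t) (Tgt t) (Map t)}" "Src s = Src t" "Tgt s = Tgt t"
    "\<And>X. X \<in> Obj (Cat M) \<Longrightarrow> Map s X = Map t X" for s t
    using that ext[of "Src t" "Tgt t" s t] by (intro arrow_eqI) auto
  have cmp: "Map t X \<in> hom SET (OMap (LFun (Src t)) X) (OMap (LFun (Tgt t)) X)"
    if "monoidal_nat_trans M (Src t) (Tgt t) (Map t)" "X \<in> Obj (Cat M)" for t X
  proof -
    interpret t: monoidal_nat_trans M "Src t" "Tgt t" "Map t" by fact
    show ?thesis using t.component that(2) by simp
  qed
  show ?thesis unfolding Th_def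
  proof (rule category_mk_category, goal_cases)
    case (1 f) then show ?case by (auto simp: monoidal_nat_trans_def)
  next
    case (2 f) then show ?case by (auto simp: monoidal_nat_trans_def)
  next
    case (6 f g) then show ?case by (auto intro: comp)
  next
    case (7 f)
    then have "lax_monoidal_functor M (Tgt f)" by (auto simp: monoidal_nat_trans_def)
    with 7 show ?case
      using comp[OF _ id] S.comp_ident_left[OF cmp] by (intro eqI) auto
  next
    case (8 f)
    then have "lax_monoidal_functor M (Src f)" by (auto simp: monoidal_nat_trans_def)
    with 8 show ?case
      using comp[OF id] S.comp_ident_right[OF cmp] by (intro eqI) auto
  next
    case (9 f g h)
    have "Comp SET (Comp SET (Map h X) (Map g X)) (Map f X) =
        Comp SET (Map h X) (Comp SET (Map g X) (Map f X))" if "X \<in> Obj (Cat M)" for X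
      using 9 that cmp[of f X] cmp[of g X] cmp[of h X] S.comp_assoc by auto
    with 9 show ?case
      using comp[OF comp] comp[OF _ comp] by (intro eqI) auto
  qed (auto intro: id)
qed

section \<open>Models and families of models\<close>

text \<open>Largeness of \<open>M\<close> lets a model structure, a function on
  \<open>Obj (Cat M)\<close>, be an element of the universe. Largeness of \<open>C\<close> is what
  then makes \<open>Mod\<close> a large category over \<open>C\<close>.\<close>

locale large_metamodel =
  metamodel M C \<Phi> + LM: large_monoidal_category M + LC: large_category C
  for M :: "('v::universe, 'v) moncat" and C :: "('v, 'v) category" and \<Phi> :: "'v metamodel_data"

text \<open>Only values at legal arguments are constrained, so different HOL functions can represent
  the same family. Both translations below cut \<open>g\<close> down to its carriers, and families
  are compared only there.\<close>

locale model_family =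
  fixes M :: "('v::universe, 'v) moncat" and C :: "('v, 'v) category"
    and \<Phi> :: "'v metamodel_data" and P :: "'v lax_data" and V :: "'v cat_arrow"
    and g :: "'v \<Rightarrow> 'v \<Rightarrow> 'v \<Rightarrow> 'v"
  assumes family_in: "a \<in> Obj (Src V) \<Longrightarrow> X \<in> Obj (Cat M) \<Longrightarrow> p \<in> lax_obj P X \<Longrightarrow>
      g X p a \<in> Phi_obj \<Phi> X (OMap (Map V) a) (OMap (Map V) a)"
    and family_natural: "a \<in> Obj (Src V) \<Longrightarrow> u \<in> hom (Cat M) X' X \<Longrightarrow> p \<in> lax_obj P X \<Longrightarrow>
      g X' (lax_arr P u p) a =
      Phi_arr \<Phi> u (Ident C (OMap (Map V) a)) (Ident C (OMap (Map V) a)) (g X p a)"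
    and family_unit: "a \<in> Obj (Src V) \<Longrightarrow> g (Unit M) (LUnitElt P) a = PhiUnit \<Phi> (OMap (Map V) a)"
    and family_mul: "a \<in> Obj (Src V) \<Longrightarrow> X \<in> Obj (Cat M) \<Longrightarrow> Y \<in> Obj (Cat M) \<Longrightarrow>
      q \<in> lax_obj P Y \<Longrightarrow> p \<in> lax_obj P X \<Longrightarrow>
      g (tensor_obj M Y X) (LMul P X Y q p) a =
      PhiMul \<Phi> X Y (OMap (Map V) a) (OMap (Map V) a) (OMap (Map V) a) (g Y q a) (g X p a)"
    and family_extranatural: "f \<in> hom (Src V) a b \<Longrightarrow> X \<in> Obj (Cat M) \<Longrightarrow> p \<in> lax_obj P X \<Longrightarrow>
      Phi_arr \<Phi> (Ident (Cat M) X) (Ident C (OMap (Map V) a)) (AMap (Map V) f) (g X p a) =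
      Phi_arr \<Phi> (Ident (Cat M) X) (AMap (Map V) f) (Ident C (OMap (Map V) b)) (g X p b)"

definition family_model ::
    "('v::universe, 'v) moncat \<Rightarrow> 'v lax_data \<Rightarrow> ('v \<Rightarrow> 'v \<Rightarrow> 'v \<Rightarrow> 'v) \<Rightarrow> 'v \<Rightarrow> 'v" where
  "family_model M P g a = vlam (Obj (Cat M)) (\<lambda>X. vlam (lax_obj P X) (\<lambda>p. g X p a))"

text \<open>The value on an arrow \<open>f\<close> leaves no choice: its ends are the models at the
  domain and codomain of \<open>f\<close>, and its middle entry must be the image of
  \<open>f\<close> under \<open>V\<close> for the triangle over \<open>C\<close> to commute.\<close>

definition family_to_Sem ::
    "('v::universe, 'v) moncat \<Rightarrow> ('v, 'v) category \<Rightarrow> 'v metamodel_data \<Rightarrow> 'v lax_data \<Rightarrow>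
      'v cat_arrow \<Rightarrow> ('v \<Rightarrow> 'v \<Rightarrow> 'v \<Rightarrow> 'v) \<Rightarrow> ('v cat_arrow, 'v cat_arrow) arrow" where
  "family_to_Sem M C \<Phi> P V g =
    (let s = (\<lambda>a. vpair (OMap (Map V) a) (family_model M P g a)) in
      Arrow V (Arrow (Src V) (mk_func (Src V) s
          (\<lambda>f. vtriple (s (Dom (Src V) f)) (AMap (Map V) f) (s (Cod (Src V) f))))
        (Mod M C \<Phi> P)) (Sem_obj M C \<Phi> P))"

text \<open>Only the second entry of the model at \<open>a\<close> is read; the first one is
  dictated by the triangle over \<open>C\<close>.\<close>

definition Sem_family ::
    "('v cat_arrow, 'v cat_arrow) arrow \<Rightarrow> 'v::universe \<Rightarrow> 'v \<Rightarrow> 'v \<Rightarrow> 'v" where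
  "Sem_family F X p a = vapp (vapp (vsnd (OMap (Map (Map F)) a)) X) p"

context large_metamodel
begin

abbreviation slice_C where "slice_C \<equiv> slice CAT C"

lemma large_lax_obj [simp]: "large (lax_obj P X)"
  by (simp add: lax_obj_def)

section \<open>The action of \<Phi> on elements\<close>

lemma Phi_arr_in:
  assumes "u \<in> hom (Cat M) X' X" "f \<in> hom C A' A" "g \<in> hom C B B'" "x \<in> Phi_obj \<Phi> X A B"
  shows "Phi_arr \<Phi> u f g x \<in> Phi_obj \<Phi> X' A' B'"
  using Map_in_SET[OF Phi.amap_hom, of "(u, f, g)" "(X, A, B)" "(X', A', B')" x] assms
  by (simp add: Phi_arr_def Phi_obj_def)

lemma Phi_arr_comp:
  assumes "u \<in> hom (Cat M) X' X" "u' \<in> hom (Cat M) X'' X'"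
    and "f \<in> hom C A' A" "f' \<in> hom C A'' A'" and "g \<in> hom C B B'" "g' \<in> hom C B' B''"
    and "x \<in> Phi_obj \<Phi> X A B"
  shows "Phi_arr \<Phi> u' f' g' (Phi_arr \<Phi> u f g x) =
    Phi_arr \<Phi> (Comp (Cat M) u u') (Comp C f f') (Comp C g' g) x"
proof -
  let ?K = "opp (Cat M) \<times>\<^sub>C opp C \<times>\<^sub>C C"
  have h: "(u, f, g) \<in> hom ?K (X, A, B) (X', A', B')" "(u', f', g') \<in>
      hom ?K (X', A', B') (X'', A'', B'')"
    using assms by auto
  have "Comp ?K (u', f', g') (u, f, g) = (Comp (Cat M) u u', Comp C f f', Comp C g' g)"
    using assms by (simp add: Comp_prod[where a = X and b = X' and c = X'' and a' = "(A, B)"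
        and b' = "(A', B')" and c' = "(A'', B'')"]
        Comp_prod[where a = A and b = A' and c = A'' and a' = B and b' = B' and c' = B''])
  then show ?thesis
    using Phi.amap_comp[OF h] Map_Comp_SET[OF Phi.amap_hom[OF h(1)] Phi.amap_hom[OF h(2)], of x]
        assms(7)
    by (simp add: Phi_arr_def Phi_obj_def)
qed

lemma Phi_arr_ident:
  "X \<in> Obj (Cat M) \<Longrightarrow> A \<in> Obj C \<Longrightarrow> B \<in> Obj C \<Longrightarrow> x \<in> Phi_obj \<Phi> X A B \<Longrightarrow>
    Phi_arr \<Phi> (Ident (Cat M) X) (Ident C A) (Ident C B) x = x"
  using Phi.amap_ident[of "(X, A, B)"] by (simp add: Phi_arr_def Phi_obj_def)

text \<open>Together with \<open>Phi_arr_right\<close> this slides the action of \<open>u\<close>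
  past those of \<open>f\<close> and \<open>g\<close>, which is why \<open>u\<close> preserves the
  end condition.\<close>

lemma Phi_arr_left:
  assumes "u \<in> hom (Cat M) X' X" "f \<in> hom C A' A" "g \<in> hom C B B'" "x \<in> Phi_obj \<Phi> X A B"
  shows "Phi_arr \<Phi> u (Ident C A') (Ident C B') (Phi_arr \<Phi> (Ident (Cat M) X) f g x) =
      Phi_arr \<Phi> u f g x"
proof -
  have o: "X \<in> Obj (Cat M)" "A' \<in> Obj C" "B' \<in> Obj C"
    using assms M.hom_obj C.hom_obj by auto
  show ?thesis
    using Phi_arr_comp[OF M.ident_hom[OF o(1)] assms(1,2) C.ident_hom[OF o(2)] assms(3)
        C.ident_hom[OF o(3)] assms(4)]
      assms(1-3)
    by (simp add: M.comp_ident_left C.comp_ident_left C.comp_ident_right)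
qed

lemma Phi_arr_right:
  assumes "u \<in> hom (Cat M) X' X" "f \<in> hom C A' A" "g \<in> hom C B B'" "x \<in> Phi_obj \<Phi> X A B"
  shows "Phi_arr \<Phi> (Ident (Cat M) X') f g (Phi_arr \<Phi> u (Ident C A) (Ident C B) x) =
      Phi_arr \<Phi> u f g x"
proof -
  have o: "X' \<in> Obj (Cat M)" "A \<in> Obj C" "B \<in> Obj C"
    using assms M.hom_obj C.hom_obj by auto
  show ?thesis
    using Phi_arr_comp[OF assms(1) M.ident_hom[OF o(1)] C.ident_hom[OF o(2)] assms(2)
        C.ident_hom[OF o(3)] assms(3,4)]
      assms(1-3)
    by (simp add: M.comp_ident_right C.comp_ident_left C.comp_ident_right)
qed

text \<open>Interchange of the two \<open>C\<close> variables: both orders compose to the action of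
  the pair \<open>f\<close>, \<open>g\<close>. It is what composition of model morphisms rests
  on.\<close>

lemma Phi_arr_commute:
  assumes "X \<in> Obj (Cat M)" "f \<in> hom C A' A" "g \<in> hom C B B'" "x \<in> Phi_obj \<Phi> X A B"
  shows "Phi_arr \<Phi> (Ident (Cat M) X) f (Ident C B') (Phi_arr \<Phi> (Ident (Cat M) X) (Ident C A) g x) =
    Phi_arr \<Phi> (Ident (Cat M) X) (Ident C A') g (Phi_arr \<Phi> (Ident (Cat M) X) f (Ident C B) x)"
proof -
  have o: "A' \<in> Obj C" "A \<in> Obj C" "B \<in> Obj C" "B' \<in> Obj C" using assms C.hom_obj by auto
  note X = M.ident_hom[OF assms(1)]
  show ?thesis
    using Phi_arr_comp[OF X X C.ident_hom[OF o(2)] assms(2,3) C.ident_hom[OF o(4)] assms(4)]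
      Phi_arr_comp[OF X X assms(2) C.ident_hom[OF o(1)] C.ident_hom[OF o(3)] assms(3,4)]
      assms(2,3)
    by (simp add: C.comp_ident_left C.comp_ident_right)
qed

section \<open>Models and the large category they form\<close>

lemma is_model_in:
  "is_model M C \<Phi> P c \<xi> \<Longrightarrow> X \<in> Obj (Cat M) \<Longrightarrow> p \<in> lax_obj P X \<Longrightarrow>
    vapp (vapp \<xi> X) p \<in> Phi_obj \<Phi> X c c"
  using vapp_in[OF large_lax_obj vapp_in[OF LM.large_obj is_model.structure_type]] by blast

lemma is_model_eqI:
  assumes "is_model M C \<Phi> P c \<xi>" "is_model M C \<Phi> P c \<xi>'"
    and "\<And>X p. X \<in> Obj (Cat M) \<Longrightarrow> p \<in> lax_obj P X \<Longrightarrow> vapp (vapp \<xi> X) p = vapp (vapp \<xi>' X) p"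
  shows "\<xi> = \<xi>'"
proof (rule vPi_eqI[OF LM.large_obj is_model.structure_type[OF assms(1)]
    is_model.structure_type[OF assms(2)]])
  fix X assume X: "X \<in> Obj (Cat M)"
  show "vapp \<xi> X = vapp \<xi>' X"
    by (rule vPi_eqI[OF _ vapp_in[OF LM.large_obj is_model.structure_type[OF assms(1)] X]
          vapp_in[OF LM.large_obj is_model.structure_type[OF assms(2)] X]])
      (use X assms(3) in auto)
qed

lemma vapp_family_model [simp]:
  "X \<in> Obj (Cat M) \<Longrightarrow> p \<in> lax_obj P X \<Longrightarrow> vapp (vapp (family_model M P g a) X) p = g X p a"
  by (simp add: family_model_def LM.large_obj)

text \<open>Isolates the condition inside the arrow set of \<open>Mod\<close>, so that closure under
  identities and composition can be stated apart from the coding by triples.\<close>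

definition model_hom :: "'v lax_data \<Rightarrow> 'v \<Rightarrow> 'v \<Rightarrow> 'v \<Rightarrow> 'v \<Rightarrow> 'v \<Rightarrow> bool" where
  "model_hom P c \<xi> f c' \<xi>' \<longleftrightarrow>
    is_model M C \<Phi> P c \<xi> \<and> is_model M C \<Phi> P c' \<xi>' \<and> f \<in> hom C c c' \<and>
    (\<forall>X\<in>Obj (Cat M). \<forall>p\<in>lax_obj P X.
       Phi_arr \<Phi> (Ident (Cat M) X) (Ident C c) f (vapp (vapp \<xi> X) p) =
       Phi_arr \<Phi> (Ident (Cat M) X) f (Ident C c') (vapp (vapp \<xi>' X) p))"

lemma Mod_eq: "Mod M C \<Phi> P = mk_category
     {vpair c \<xi> | c \<xi>. is_model M C \<Phi> P c \<xi>}
     {vtriple (vpair c \<xi>) f (vpair c' \<xi>') | c \<xi> f c' \<xi>'. model_hom P c \<xi> f c' \<xi>'}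
     (\<lambda>m. vsrc m) (\<lambda>m. vtgt m)
     (\<lambda>s. vtriple s (Ident C (vfst s)) s)
     (\<lambda>n m. vtriple (vsrc m) (Comp C (vmid n) (vmid m)) (vtgt n))"
  by (simp add: Mod_def model_hom_def)

lemma Obj_Mod: "s \<in> Obj (Mod M C \<Phi> P) \<longleftrightarrow> (\<exists>c \<xi>. s = vpair c \<xi> \<and> is_model M C \<Phi> P c \<xi>)"
  by (auto simp: Mod_def)

lemma in_hom_Mod: "m \<in> hom (Mod M C \<Phi> P) s t \<longleftrightarrow>
    (\<exists>c \<xi> f c' \<xi>'. s = vpair c \<xi> \<and> t = vpair c' \<xi>' \<and> m = vtriple s f t \<and> model_hom P c \<xi> f c' \<xi>')"
  by (auto simp: Mod_eq in_hom_mk_category)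

lemma Dom_Cod_Mod:
  "m \<in> Arr (Mod M C \<Phi> P) \<Longrightarrow> Dom (Mod M C \<Phi> P) m = vsrc m"
  "m \<in> Arr (Mod M C \<Phi> P) \<Longrightarrow> Cod (Mod M C \<Phi> P) m = vtgt m"
  by (simp_all add: Mod_def)

lemma Ident_Mod:
  "s \<in> Obj (Mod M C \<Phi> P) \<Longrightarrow> Ident (Mod M C \<Phi> P) s = vtriple s (Ident C (vfst s)) s"
  by (simp add: Mod_def)

lemma Comp_Mod:
  assumes "m \<in> hom (Mod M C \<Phi> P) r s" "n \<in> hom (Mod M C \<Phi> P) s t"
  shows "Comp (Mod M C \<Phi> P) n m = vtriple r (Comp C (vmid n) (vmid m)) t"
proof -
  have "m \<in> Arr (Mod M C \<Phi> P)" "n \<in> Arr (Mod M C \<Phi> P)" "vsrc m = r" "vtgt m = s" "vsrc n =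
      s" "vtgt n = t"
    using assms by (auto simp: hom_def Dom_Cod_Mod)
  then show ?thesis by (simp add: Mod_def)
qed

lemma model_hom_ident: "is_model M C \<Phi> P c \<xi> \<Longrightarrow> model_hom P c \<xi> (Ident C c) c \<xi>"
  by (simp add: model_hom_def C.ident_hom is_model.carrier_obj)

text \<open>The two squares are pasted at the middle model \<xi>': the condition for
  \<open>f\<close> brings in its value, the covariant action of \<open>h\<close> is exchanged with
  the contravariant action of \<open>f\<close>, and then the condition for \<open>h\<close>
  applies.\<close>

lemma model_hom_comp:
  assumes f: "model_hom P c \<xi> f c' \<xi>'" and h: "model_hom P c' \<xi>' h c'' \<xi>''"
  shows "model_hom P c \<xi> (Comp C h f) c'' \<xi>''"
  unfolding model_hom_def
proof (intro conjI ballI)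
  have fh: "f \<in> hom C c c'" "h \<in> hom C c' c''" using f h by (auto simp: model_hom_def)
  then show "Comp C h f \<in> hom C c c''" by (rule C.comp_hom)
  fix X p assume X: "X \<in> Obj (Cat M)" and p: "p \<in> lax_obj P X"
  let ?i = "Ident (Cat M) X"
  let ?x = "vapp (vapp \<xi> X) p" and ?x' = "vapp (vapp \<xi>' X) p" and ?x'' = "vapp (vapp \<xi>'' X) p"
  have x: "?x \<in> Phi_obj \<Phi> X c c" "?x' \<in> Phi_obj \<Phi> X c' c'" "?x'' \<in> Phi_obj \<Phi> X c'' c''"
    using f h X p is_model_in unfolding model_hom_def by blast+
  have o: "c \<in> Obj C" "c' \<in> Obj C" "c'' \<in> Obj C" using C.hom_obj fh by auto
  note i = M.ident_hom[OF X] C.ident_hom[OF o(1)] C.ident_hom[OF o(2)] C.ident_hom[OF o(3)]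
  have ii: "Comp (Cat M) ?i ?i = ?i" "Comp C (Ident C c) (Ident C c) = Ident C c"
    "Comp C (Ident C c'') (Ident C c'') = Ident C c''"
    using M.comp_ident_left[OF i(1)] C.comp_ident_left[OF i(2)] C.comp_ident_left[OF i(4)] by auto
  have "Phi_arr \<Phi> ?i (Ident C c) (Comp C h f) ?x =
      Phi_arr \<Phi> ?i (Ident C c) h (Phi_arr \<Phi> ?i (Ident C c) f ?x)"
    using Phi_arr_comp[OF i(1,1) i(2,2) fh x(1)] ii by simp
  also have "\<dots> = Phi_arr \<Phi> ?i (Ident C c) h (Phi_arr \<Phi> ?i f (Ident C c') ?x')"
    using f X p by (simp add: model_hom_def)
  also have "\<dots> = Phi_arr \<Phi> ?i f (Ident C c'') (Phi_arr \<Phi> ?i (Ident C c') h ?x')"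
    using Phi_arr_commute[OF X fh x(2)] by simp
  also have "\<dots> = Phi_arr \<Phi> ?i f (Ident C c'') (Phi_arr \<Phi> ?i h (Ident C c'') ?x'')"
    using h X p by (simp add: model_hom_def)
  also have "\<dots> = Phi_arr \<Phi> ?i (Comp C h f) (Ident C c'') ?x''"
    using Phi_arr_comp[OF i(1,1) fh(2,1) i(4,4) x(3)] ii by simp
  finally show "Phi_arr \<Phi> ?i (Ident C c) (Comp C h f) ?x =
    Phi_arr \<Phi> ?i (Comp C h f) (Ident C c'') ?x''" .
qed (use f h in \<open>auto simp: model_hom_def\<close>)

lemma category_Mod: "category (Mod M C \<Phi> P)"
  unfolding Mod_eq
proof (rule category_mk_category, goal_cases)
  case (6 f g)
  then show ?case by simp (metis model_hom_comp vpair_inject vtriple_proj)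
next
  case (9 f g h)
  then show ?case by (auto simp: model_hom_def intro: C.comp_assoc)
qed (auto intro: model_hom_ident simp: C.comp_ident_left C.comp_ident_right, auto simp:
    model_hom_def
  C.comp_ident_left C.comp_ident_right)

text \<open>Objects lie in a sum over \<open>Obj C\<close> of iterated products, all indexed by
  large sets; arrows lie in the triples of an object, an arrow of \<open>C\<close> and an object.
  This puts \<open>Mod\<close> into \<open>CAT\<close>.\<close>

lemma large_category_Mod: "large_category (Mod M C \<Phi> P)"
proof -
  let ?K = "Mod M C \<Phi> P"
  have "large {vpair c \<xi> | c \<xi>. c \<in> Obj C \<and>
      \<xi> \<in> vPi (Obj (Cat M)) (\<lambda>X. vPi (lax_obj P X) (\<lambda>_. Phi_obj \<Phi> X c c))}"
    by (intro large_vpairs large_vPi LM.large_obj LC.large_obj large_lax_obj)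
      (simp add: Phi_obj_def)
  then have O: "large (Obj ?K)"
    by (rule large_subset) (use is_model.carrier_obj is_model.structure_type
        in \<open>auto simp: Obj_Mod\<close>)
  have "large {vpair s m | s m. s \<in> Obj ?K \<and> m \<in> {vpair f t | f t. f \<in> Arr C \<and> t \<in> Obj ?K}}"
    by (intro large_vpairs O LC.large_arr)
  moreover have "Arr ?K \<subseteq> {vpair s m | s m. s \<in> Obj ?K \<and> m \<in> {vpair f t | f t. f \<in> Arr C \<and> t \<in>
      Obj ?K}}"
    by (auto simp: Mod_eq model_hom_def vtriple_def hom_def)
  ultimately have "large (Arr ?K)" by (rule large_subset)
  with O category_Mod show ?thesis
    by (simp add: large_category_def large_category_axioms_def)
qed

section \<open>The forgetful functor from models and the arrows into it\<close>

lemma Src_Sem_obj [simp]: "Src (Sem_obj M C \<Phi> P) = Mod M C \<Phi> P"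
  by (simp add: Sem_obj_def)

lemma OMap_Sem_obj [simp]:
  "s \<in> Obj (Mod M C \<Phi> P) \<Longrightarrow> OMap (Map (Sem_obj M C \<Phi> P)) s = vfst s"
  by (simp add: Sem_obj_def)

lemma AMap_Sem_obj [simp]:
  "m \<in> Arr (Mod M C \<Phi> P) \<Longrightarrow> AMap (Map (Sem_obj M C \<Phi> P)) m = vmid m"
  "m \<in> hom (Mod M C \<Phi> P) s t \<Longrightarrow> AMap (Map (Sem_obj M C \<Phi> P)) m = vmid m"
  by (simp_all add: Sem_obj_def)

lemma Sem_obj_in: "Sem_obj M C \<Phi> P \<in> Obj slice_C"
proof -
  have "is_functor (Mod M C \<Phi> P) C (mk_func (Mod M C \<Phi> P) (\<lambda>s. vfst s) (\<lambda>m. vmid m))"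
  proof (rule is_functor_mk_func[OF category_Mod C.category_axioms])
    show "vfst s \<in> Obj C" if "s \<in> Obj (Mod M C \<Phi> P)" for s
      using that by (auto simp: Obj_Mod is_model.carrier_obj)
    show "vmid m \<in> hom C (vfst s) (vfst t)" if "m \<in> hom (Mod M C \<Phi> P) s t" for m s t
      using that by (auto simp: in_hom_Mod model_hom_def)
  qed (simp_all add: Ident_Mod Comp_Mod)
  then show ?thesis
    by (simp add: Obj_slice_CAT large_category_Mod LC.large_category_axioms Sem_obj_def)
qed

text \<open>Once the values are known to be models and model morphisms, functoriality is inherited
  from \<open>V\<close>, because identities and composites in \<open>Mod\<close> are those of
  \<open>C\<close> on the middle entry.\<close>

lemma family_to_Sem_hom:
  assumes P: "lax_monoidal_functor M P" and V: "V \<in> Obj slice_C" and g: "model_family M C \<Phi> P V g"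
  shows "family_to_Sem M C \<Phi> P V g \<in> hom slice_C V (Sem_obj M C \<Phi> P)"
proof -
  interpret V: is_functor "Src V" C "Map V" using V by (simp add: Obj_slice_CAT)
  interpret P: lax_monoidal_functor M P by fact
  interpret g: model_family M C \<Phi> P V g by fact
  let ?K = "Mod M C \<Phi> P"
  define s where "s = (\<lambda>a. vpair (OMap (Map V) a) (family_model M P g a))"
  define G where "G = mk_func (Src V) s (\<lambda>f. vtriple (s (Dom (Src V) f)) (AMap (Map V) f)
      (s (Cod (Src V) f)))"
  have m: "is_model M C \<Phi> P (OMap (Map V) a) (family_model M P g a)" if a: "a \<in> Obj (Src V)" for a
  proof
    show "family_model M P g a \<in> vPi (Obj (Cat M))
        (\<lambda>X. vPi (lax_obj P X) (\<lambda>_. Phi_obj \<Phi> X (OMap (Map V) a) (OMap (Map V) a)))"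
      unfolding family_model_def by (intro vlam_in_vPi g.family_in a)
  next
    fix u X' X p assume u: "u \<in> hom (Cat M) X' X" and p: "p \<in> lax_obj P X"
    show "vapp (vapp (family_model M P g a) X') (lax_arr P u p) =
        Phi_arr \<Phi> u (Ident C (OMap (Map V) a)) (Ident C (OMap (Map V) a))
            (vapp (vapp (family_model M P g a) X) p)"
      using M.hom_obj[OF u] P.lax_arr_in[OF u p] p g.family_natural[OF a u p] by simp
  next
    fix X Y q p assume "X \<in> Obj (Cat M)" "Y \<in> Obj (Cat M)" "q \<in> lax_obj P Y" "p \<in> lax_obj P X"
    then show "vapp (vapp (family_model M P g a) (tensor_obj M Y X)) (LMul P X Y q p) =
        PhiMul \<Phi> X Y (OMap (Map V) a) (OMap (Map V) a) (OMap (Map V) a)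
          (vapp (vapp (family_model M P g a) Y) q) (vapp (vapp (family_model M P g a) X) p)"
      using a P.lax_mul_in[of X Y q p] M.tensor.omap_obj[of "(Y, X)"] by (simp add: g.family_mul)
  qed (use a V.omap_obj M.unit_obj P.lax_unit_type g.family_unit in simp_all)
  have mh: "model_hom P (OMap (Map V) a) (family_model M P g a) (AMap (Map V) f)
      (OMap (Map V) b) (family_model M P g b)" if f: "f \<in> hom (Src V) a b" for f a b
    using V.A.hom_obj[OF f] V.amap_hom[OF f] m g.family_extranatural[OF f]
        by (simp add: model_hom_def)
  then have h: "vtriple (s (Dom (Src V) f)) (AMap (Map V) f) (s (Cod (Src V) f)) \<in>
      hom ?K (s a) (s b)"
    if "f \<in> hom (Src V) a b" for f a b
    using that unfolding in_hom_Mod s_def by (auto simp: hom_def)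
  have so: "s a \<in> Obj ?K" if "a \<in> Obj (Src V)" for a using m[OF that] by (auto simp: Obj_Mod s_def)
  have G: "is_functor (Src V) ?K G" unfolding G_def
  proof (rule is_functor_mk_func[OF V.A.category_axioms category_Mod so h])
    fix a assume a: "a \<in> Obj (Src V)"
    then show "vtriple (s (Dom (Src V) (Ident (Src V) a))) (AMap (Map V) (Ident (Src V) a))
        (s (Cod (Src V) (Ident (Src V) a))) = Ident ?K (s a)"
      using V.A.ident_hom[OF a] so[OF a] by (simp add: hom_def Ident_Mod V.amap_ident s_def)
  next
    fix f k a b c assume fk: "f \<in> hom (Src V) a b" "k \<in> hom (Src V) b c"
    show "vtriple (s (Dom (Src V) (Comp (Src V) k f))) (AMap (Map V) (Comp (Src V) k f))
           (s (Cod (Src V) (Comp (Src V) k f))) =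
        Comp ?K (vtriple (s (Dom (Src V) k)) (AMap (Map V) k) (s (Cod (Src V) k)))
          (vtriple (s (Dom (Src V) f)) (AMap (Map V) f) (s (Cod (Src V) f)))"
      using V.A.comp_hom[OF fk] V.amap_comp[OF fk]
      by (subst Comp_Mod[OF h[OF fk(1)] h[OF fk(2)]]) (simp add: hom_def)
  qed
  have "comp_func (Src V) (Map (Sem_obj M C \<Phi> P)) G = Map V"
  proof (rule func_eqI[of _ "Src V"])
    show "OMap (comp_func (Src V) (Map (Sem_obj M C \<Phi> P)) G) a = OMap (Map V) a"
      if "a \<in> Obj (Src V)" for a
      \<comment> \<open>\<open>s\<close> stays folded in the first pass, so that \<open>so\<close>
        can discharge the membership condition of \<open>OMap_Sem_obj\<close>.\<close>
      using that so[OF that] by (simp add: G_def) (simp add: s_def)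
    show "AMap (comp_func (Src V) (Map (Sem_obj M C \<Phi> P)) G) f = AMap (Map V) f"
      if "f \<in> Arr (Src V)" for f
      using that h[OF V.A.arr_in_hom[OF that]] by (simp add: G_def AMap_Sem_obj)
  qed (simp_all add: comp_func_def V.omap_ext V.amap_ext)
  with G show ?thesis
    unfolding in_hom_slice_CAT
    by (simp add: V Sem_obj_in family_to_Sem_def Let_def s_def[symmetric] G_def[symmetric])
qed

lemma Sem_family_family_to_Sem [simp]:
  "a \<in> Obj (Src V) \<Longrightarrow> X \<in> Obj (Cat M) \<Longrightarrow> p \<in> lax_obj P X \<Longrightarrow>
    Sem_family (family_to_Sem M C \<Phi> P V g) X p a = g X p a"
  by (simp add: Sem_family_def family_to_Sem_def)

context
  fixes P V F
  assumes F: "F \<in> hom slice_C V (Sem_obj M C \<Phi> P)"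
begin

interpretation G: is_functor "Src V" "Mod M C \<Phi> P" "Map (Map F)"
  using F by (simp add: in_hom_slice_CAT)

text \<open>The triangle over \<open>C\<close> fixes the carrier, so on objects \<open>F\<close>
  only chooses a model structure on the image of \<open>a\<close> under \<open>V\<close>.\<close>

lemma over_Sem_obj:
  assumes a: "a \<in> Obj (Src V)"
  shows "\<exists>\<xi>. OMap (Map (Map F)) a = vpair (OMap (Map V) a) \<xi> \<and> is_model M C \<Phi> P (OMap (Map V) a) \<xi>"
proof -
  have "vfst (OMap (Map (Map F)) a) = OMap (comp_func (Src V) (Map (Sem_obj M C \<Phi> P)) (Map (Map F)))
      a"
    using a G.omap_obj[OF a] by simp
  also have "\<dots> = OMap (Map V) a" using F by (simp add: in_hom_slice_CAT)
  finally show ?thesis using G.omap_obj[OF a] by (auto simp: Obj_Mod)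
qed

text \<open>Arrows of \<open>Mod\<close> carry their ends, and the triangle fixes the middle entry;
  hence \<open>F\<close> is determined by its object part.\<close>

lemma over_Sem_arr:
  assumes f: "f \<in> hom (Src V) a b"
  shows "AMap (Map (Map F)) f =
    vtriple (OMap (Map (Map F)) a) (AMap (Map V) f) (OMap (Map (Map F)) b)"
proof -
  have "vmid (AMap (Map (Map F)) f) = AMap (comp_func (Src V) (Map (Sem_obj M C \<Phi> P)) (Map (Map F)))
      f"
    using f G.amap_hom[OF f] by (simp add: AMap_Sem_obj(2))
  also have "\<dots> = AMap (Map V) f" using F by (simp add: in_hom_slice_CAT)
  finally show ?thesis using G.amap_hom[OF f] by (auto simp: in_hom_Mod)
qed

lemma Sem_family_is_family: "model_family M C \<Phi> P V (Sem_family F)"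
proof
  fix a X p assume "a \<in> Obj (Src V)" "X \<in> Obj (Cat M)" "p \<in> lax_obj P X"
  then show "Sem_family F X p a \<in> Phi_obj \<Phi> X (OMap (Map V) a) (OMap (Map V) a)"
    using over_Sem_obj[of a] by (auto simp: Sem_family_def is_model_in)
next
  fix f a b X p assume f: "f \<in> hom (Src V) a b" and "X \<in> Obj (Cat M)" "p \<in> lax_obj P X"
  then show "Phi_arr \<Phi> (Ident (Cat M) X) (Ident C (OMap (Map V) a)) (AMap (Map V) f)
      (Sem_family F X p a) =
      Phi_arr \<Phi> (Ident (Cat M) X) (AMap (Map V) f) (Ident C (OMap (Map V) b)) (Sem_family F X p b)"
    using G.amap_hom[OF f] over_Sem_arr[OF f] over_Sem_obj[of a] over_Sem_obj[of b]
        G.A.hom_obj[OF f]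
    by (auto simp: Sem_family_def in_hom_Mod model_hom_def)
qed (use over_Sem_obj in \<open>fastforce simp: Sem_family_def
      dest: is_model.structure_natural is_model.structure_unit is_model.structure_mul\<close>)+

end

lemma hom_Sem_eqI:
  assumes F: "F \<in> hom slice_C V (Sem_obj M C \<Phi> P)" and G: "G \<in> hom slice_C V (Sem_obj M C \<Phi> P)"
    and eq: "\<And>a X p. a \<in> Obj (Src V) \<Longrightarrow> X \<in> Obj (Cat M) \<Longrightarrow> p \<in> lax_obj P X \<Longrightarrow>
      Sem_family F X p a = Sem_family G X p a"
  shows "F = G"
proof -
  interpret F: is_functor "Src V" "Mod M C \<Phi> P" "Map (Map F)"
    using F by (simp add: in_hom_slice_CAT)
  interpret G: is_functor "Src V" "Mod M C \<Phi> P" "Map (Map G)"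
    using G by (simp add: in_hom_slice_CAT)
  have o: "OMap (Map (Map F)) a = OMap (Map (Map G)) a" if a: "a \<in> Obj (Src V)" for a
  proof -
    obtain \<xi> \<xi>' where \<xi>: "OMap (Map (Map F)) a = vpair (OMap (Map V) a) \<xi>"
        "OMap (Map (Map G)) a = vpair (OMap (Map V) a) \<xi>'"
      and m: "is_model M C \<Phi> P (OMap (Map V) a) \<xi>" "is_model M C \<Phi> P (OMap (Map V) a) \<xi>'"
      using over_Sem_obj[OF F a] over_Sem_obj[OF G a] by blast
    have "\<xi> = \<xi>'" by (rule is_model_eqI[OF m]) (use eq[OF a] \<xi> in \<open>simp add: Sem_family_def\<close>)
    then show ?thesis by (simp add: \<xi>)
  qed
  have "Map (Map F) = Map (Map G)"
  proof (rule func_eqI[OF F.omap_ext F.amap_ext G.omap_ext G.amap_ext o])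
    fix f assume "f \<in> Arr (Src V)"
    note f = F.A.arr_in_hom[OF this]
    show "AMap (Map (Map F)) f = AMap (Map (Map G)) f"
      using over_Sem_arr[OF F f] over_Sem_arr[OF G f] F.A.hom_obj[OF f] o by simp
  qed
  then show ?thesis using F G unfolding in_hom_slice_CAT by (intro arrow_eqI) auto
qed

section \<open>Sem on arrows of theories\<close>

lemma Sem_family_Comp:
  "F \<in> hom slice_C U V \<Longrightarrow> G \<in> hom slice_C V W \<Longrightarrow> a \<in> Obj (Src U) \<Longrightarrow>
    Sem_family (Comp slice_C G F) X p a = Sem_family G X p (OMap (Map (Map F)) a)"
  by (simp add: Comp_slice_CAT Sem_family_def)

lemma Sem_family_Ident:
  "s \<in> Obj (Mod M C \<Phi> P) \<Longrightarrow>
    Sem_family (Ident slice_C (Sem_obj M C \<Phi> P)) X p s = vapp (vapp (vsnd s) X) p"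
  by (simp add: Ident_slice_CAT Sem_obj_in Sem_family_def)

text \<open>Take \<open>V\<close> to be the forgetful functor itself: an object \<open>s\<close> of
  its domain is already a model of \<open>P\<close>, which gives a tautological family. Precomposing
  that family with \<open>t\<close> gives \<open>Sem_arr\<close>, so its typing is a case of
  \<open>family_to_Sem_hom\<close>.\<close>

lemma Sem_arr_eq_family:
  assumes t: "t \<in> hom (Th M) Q P"
  shows "Sem_arr M C \<Phi> t =
    family_to_Sem M C \<Phi> Q (Sem_obj M C \<Phi> P) (\<lambda>X q s. vapp (vapp (vsnd s) X) (Map (Map t X) q))"
proof -
  have st: "Src t = Q" "Tgt t = P" using t by (auto simp: in_hom_Th)
  interpret K: category "Mod M C \<Phi> P" by (rule category_Mod)
  have s: "precomp_model M t s = vpair (OMap (Map (Sem_obj M C \<Phi> P)) s)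
      (family_model M Q (\<lambda>X q s. vapp (vapp (vsnd s) X) (Map (Map t X) q)) s)"
    if "s \<in> Obj (Mod M C \<Phi> P)" for s
    using that by (simp add: precomp_model_def family_model_def st)
  show ?thesis
    unfolding Sem_arr_def family_to_Sem_def Let_def st
    using s K.dom_obj K.cod_obj
    by (auto simp: Dom_Cod_Mod intro!: func_eqI[of _ "Mod M C \<Phi> P"])
qed

lemma Sem_arr_family:
  assumes t: "t \<in> hom (Th M) Q P"
  shows "model_family M C \<Phi> Q (Sem_obj M C \<Phi> P) (\<lambda>X q s. vapp (vapp (vsnd s) X) (Map (Map t X) q))"
proof -
  interpret t: monoidal_nat_trans M Q P "Map t" using t by (simp add: in_hom_Th)
  show ?thesis
  proof
    fix m r s X q assume m: "m \<in> hom (Src (Sem_obj M C \<Phi> P)) r s"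
        and "X \<in> Obj (Cat M)" "q \<in> lax_obj Q X"
    moreover have "r \<in> Obj (Mod M C \<Phi> P)" "s \<in> Obj (Mod M C \<Phi> P)"
      using m category.hom_obj[OF category_Mod] by auto
    ultimately show "Phi_arr \<Phi> (Ident (Cat M) X) (Ident C (OMap (Map (Sem_obj M C \<Phi> P)) r))
        (AMap (Map (Sem_obj M C \<Phi> P)) m) (vapp (vapp (vsnd r) X) (Map (Map t X) q)) =
      Phi_arr \<Phi> (Ident (Cat M) X) (AMap (Map (Sem_obj M C \<Phi> P)) m)
        (Ident C (OMap (Map (Sem_obj M C \<Phi> P)) s)) (vapp (vapp (vsnd s) X) (Map (Map t X) q))"
      by (auto simp: in_hom_Mod model_hom_def t.map_in AMap_Sem_obj(2))
  next
    fix s u X' X q assume s: "s \<in> Obj (Src (Sem_obj M C \<Phi> P))"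
      and u: "u \<in> hom (Cat M) X' X" and q: "q \<in> lax_obj Q X"
    have "Map (Map t X) q \<in> lax_obj P X" using M.hom_obj[OF u] q t.map_in by simp
    then show "vapp (vapp (vsnd s) X') (Map (Map t X') (lax_arr Q u q)) =
      Phi_arr \<Phi> u (Ident C (OMap (Map (Sem_obj M C \<Phi> P)) s))
          (Ident C (OMap (Map (Sem_obj M C \<Phi> P)) s))
        (vapp (vapp (vsnd s) X) (Map (Map t X) q))"
      using s is_model.structure_natural[OF _ u] by (auto simp: Obj_Mod t.map_natural[OF u q])
  qed (auto simp: Obj_Mod t.map_in t.preserves_unit t.preserves_mul is_model_in
      is_model.structure_unit is_model.structure_mul)
qed

lemma Sem_arr_hom:
  assumes t: "t \<in> hom (Th M) Q P"
  shows "Sem_arr M C \<Phi> t \<in> hom slice_C (Sem_obj M C \<Phi> P) (Sem_obj M C \<Phi> Q)"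
proof -
  have "lax_monoidal_functor M Q" using t by (simp add: in_hom_Th monoidal_nat_trans_def)
  then show ?thesis
    unfolding Sem_arr_eq_family[OF t] by (rule family_to_Sem_hom[OF _ Sem_obj_in
        Sem_arr_family[OF t]])
qed

text \<open>Counterpart of \<open>Sem_family_Comp\<close>: arrows of the slice reindex a family in
  \<open>a\<close>, arrows of theories reindex it in the argument from the theory.\<close>

lemma Sem_family_Comp_Sem_arr:
  assumes t: "t \<in> hom (Th M) Q P" and F: "F \<in> hom slice_C V (Sem_obj M C \<Phi> P)"
    and "a \<in> Obj (Src V)" "X \<in> Obj (Cat M)" "q \<in> lax_obj Q X"
  shows "Sem_family (Comp slice_C (Sem_arr M C \<Phi> t) F) X q a = Sem_family F X (Map (Map t X) q) a"
proof -
  have "OMap (Map (Map F)) a \<in> Obj (Mod M C \<Phi> P)"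
    using over_Sem_obj[OF F assms(3)] by (auto simp: Obj_Mod)
  then show ?thesis
    unfolding Sem_family_Comp[OF F Sem_arr_hom[OF t] assms(3)]
    using assms(4,5) by (simp add: Sem_arr_eq_family[OF t]) (simp add: Sem_family_def)
qed

lemma Sem_functor: "is_functor (opp (Th M)) slice_C (Sem M C \<Phi>)"
proof -
  interpret T: category "Th M" by (rule category_Th)
  interpret K: category slice_C by (rule category_slice_CAT)
  have fam: "Sem_family (Sem_arr M C \<Phi> t) X q s = vapp (vapp (vsnd s) X) (Map (Map t X) q)"
    if "t \<in> hom (Th M) Q P" "s \<in> Obj (Mod M C \<Phi> P)" "X \<in> Obj (Cat M)" "q \<in> lax_obj Q X"
        for t P Q s X q
    using that by (simp add: Sem_arr_eq_family)
  show ?thesis unfolding Sem_def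
  proof (rule is_functor_mk_func[OF category_opp[OF category_Th] category_slice_CAT])
    fix P assume P: "P \<in> Obj (opp (Th M))"
    then have i: "Ident (Th M) P \<in> hom (Th M) P P" using T.ident_hom by simp
    have "Sem_arr M C \<Phi> (Ident (Th M) P) = Ident slice_C (Sem_obj M C \<Phi> P)"
      by (rule hom_Sem_eqI[OF Sem_arr_hom[OF i] K.ident_hom[OF Sem_obj_in]])
        (use P in \<open>simp add: fam[OF i] Map_Ident_Th Sem_family_Ident\<close>)
    then show "Sem_arr M C \<Phi> (Ident (opp (Th M)) P) = Ident slice_C (Sem_obj M C \<Phi> P)"
      using P by simp
  next
    fix s t P Q R assume "s \<in> hom (opp (Th M)) P Q" "t \<in> hom (opp (Th M)) Q R"
    then have s: "s \<in> hom (Th M) Q P" and t: "t \<in> hom (Th M) R Q" by auto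
    interpret t: monoidal_nat_trans M R Q "Map t" using t by (simp add: in_hom_Th)
    have "Sem_arr M C \<Phi> (Comp (Th M) s t) = Comp slice_C (Sem_arr M C \<Phi> t) (Sem_arr M C \<Phi> s)"
    proof (rule hom_Sem_eqI[OF Sem_arr_hom[OF T.comp_hom[OF t s]]
        K.comp_hom[OF Sem_arr_hom[OF s] Sem_arr_hom[OF t]]])
      fix a X p assume "a \<in> Obj (Src (Sem_obj M C \<Phi> P))" "X \<in> Obj (Cat M)" "p \<in> lax_obj R X"
      then show "Sem_family (Sem_arr M C \<Phi> (Comp (Th M) s t)) X p a =
          Sem_family (Comp slice_C (Sem_arr M C \<Phi> t) (Sem_arr M C \<Phi> s)) X p a"
        using Sem_family_Comp_Sem_arr[OF t Sem_arr_hom[OF s]] T.comp_hom[OF t s] t.map_in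
        by (simp add: fam[OF T.comp_hom[OF t s]] fam[OF s] Map_Comp_Th[OF s t])
    qed
    then show "Sem_arr M C \<Phi> (Comp (opp (Th M)) t s) =
        Comp slice_C (Sem_arr M C \<Phi> t) (Sem_arr M C \<Phi> s)"
      by simp
  qed (simp_all add: Sem_obj_in Sem_arr_hom)
qed

end

section \<open>The structure functor and the adjunction\<close>

definition family_to_Str ::
    "('v::universe, 'v) moncat \<Rightarrow> ('v, 'v) category \<Rightarrow> 'v metamodel_data \<Rightarrow> 'v lax_data \<Rightarrow>
      'v cat_arrow \<Rightarrow> ('v \<Rightarrow> 'v \<Rightarrow> 'v \<Rightarrow> 'v) \<Rightarrow> 'v lax_arrow" where
  "family_to_Str M C \<Phi> P V g =
     Arrow P (\<lambda>X\<in>Obj (Cat M). Arrow (OMap (LFun P) X)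
       (\<lambda>p\<in>lax_obj P X. vlam (Obj (Src V)) (\<lambda>a. g X p a)) (Str_end M \<Phi> V X)) (Str_obj M C \<Phi> V)"

definition Str_family :: "'v::universe lax_arrow \<Rightarrow> 'v \<Rightarrow> 'v \<Rightarrow> 'v \<Rightarrow> 'v" where
  "Str_family t X p a = vapp (Map (Map t X) p) a"

context large_metamodel
begin

text \<open>Joint naturality with identities in all variables but one; the tensor of two identities
  is again an identity. This and \<open>mul_natural_right\<close> move an arrow of \<open>C\<close>
  into or out of an outer slot of the multiplication.\<close>

lemma mul_natural_left:
  assumes X: "X \<in> Obj (Cat M)" and Y: "Y \<in> Obj (Cat M)" and A: "A \<in> Obj C" and B: "B \<in> Obj C"
    and h: "h \<in> hom C D D'" and y: "y \<in> Phi_obj \<Phi> Y B D" and x: "x \<in> Phi_obj \<Phi> X A B"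
  shows "PhiMul \<Phi> X Y A B D' (Phi_arr \<Phi> (Ident (Cat M) Y) (Ident C B) h y) x =
    Phi_arr \<Phi> (Ident (Cat M) (tensor_obj M Y X)) (Ident C A) h (PhiMul \<Phi> X Y A B D y x)"
  using mul_natural[OF M.ident_hom[OF X] M.ident_hom[OF Y] C.ident_hom[OF A] B h y x]
    M.tensor.amap_ident[of "(Y, X)"] X Y Phi_arr_ident[OF X A B x] by simp

lemma mul_natural_right:
  assumes X: "X \<in> Obj (Cat M)" and Y: "Y \<in> Obj (Cat M)" and f: "f \<in> hom C A' A" and B: "B \<in> Obj C"
    and D: "D \<in> Obj C" and y: "y \<in> Phi_obj \<Phi> Y B D" and x: "x \<in> Phi_obj \<Phi> X A B"
  shows "PhiMul \<Phi> X Y A' B D y (Phi_arr \<Phi> (Ident (Cat M) X) f (Ident C B) x) =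
    Phi_arr \<Phi> (Ident (Cat M) (tensor_obj M Y X)) f (Ident C D) (PhiMul \<Phi> X Y A B D y x)"
  using mul_natural[OF M.ident_hom[OF X] M.ident_hom[OF Y] f B C.ident_hom[OF D] y x]
    M.tensor.amap_ident[of "(Y, X)"] X Y Phi_arr_ident[OF Y B D y] by simp

section \<open>Ends of \<Phi> along a fixed functor into \<open>C\<close>\<close>

context
  fixes V :: "'v cat_arrow"
  assumes V: "V \<in> Obj slice_C"
begin

interpretation A: large_category "Src V" using V by (simp add: Obj_slice_CAT)
interpretation V: is_functor "Src V" C "Map V" using V by (simp add: Obj_slice_CAT)

text \<open>The compatible families form a subset of a large product, so \<open>vset\<close> in
  \<open>end_SET\<close> does code them. Since \<open>V\<close> preserves identities, the end
  condition for \<open>Phi_along\<close> becomes one for \<open>Phi_arr\<close>.\<close>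

lemma in_Str_end:
  assumes X: "X \<in> Obj (Cat M)"
  shows "x \<in> elts (Str_end M \<Phi> V X) \<longleftrightarrow>
    x \<in> vPi (Obj (Src V)) (\<lambda>a. Phi_obj \<Phi> X (OMap (Map V) a) (OMap (Map V) a)) \<and>
    (\<forall>f a b. f \<in> hom (Src V) a b \<longrightarrow>
      Phi_arr \<Phi> (Ident (Cat M) X) (Ident C (OMap (Map V) a)) (AMap (Map V) f) (vapp x a) =
      Phi_arr \<Phi> (Ident (Cat M) X) (AMap (Map V) f) (Ident C (OMap (Map V) b)) (vapp x b))"
    (is "_ \<longleftrightarrow> ?P x")
proof -
  let ?T = "Phi_along M \<Phi> V X"
  have "elts (OMap ?T (a, a)) = Phi_obj \<Phi> X (OMap (Map V) a) (OMap (Map V) a)" if "a \<in> Obj (Src V)"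
      for a
    using that by (simp add: Phi_along_def Phi_obj_def)
  then have p: "vPi (Obj (Src V)) (\<lambda>a. elts (OMap ?T (a, a))) =
      vPi (Obj (Src V)) (\<lambda>a. Phi_obj \<Phi> X (OMap (Map V) a) (OMap (Map V) a))"
    by (rule vPi_cong)
  have "large (vPi (Obj (Src V)) (\<lambda>a. Phi_obj \<Phi> X (OMap (Map V) a) (OMap (Map V) a)))"
    by (intro large_vPi A.large_obj) (simp add: Phi_obj_def)
  then have l: "large {x \<in> vPi (Obj (Src V)) (\<lambda>a. elts (OMap ?T (a, a))).
     \<forall>a\<in>Obj (Src V). \<forall>b\<in>Obj (Src V). \<forall>f\<in>hom (Src V) a b.
       Map (AMap ?T (Ident (Src V) a, f)) (vapp x a) =
           Map (AMap ?T (f, Ident (Src V) b)) (vapp x b)}"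
    unfolding p by (rule large_subset) auto
  have m: "Map (AMap ?T (Ident (Src V) a, f)) = Phi_arr \<Phi> (Ident (Cat M) X)
      (Ident C (OMap (Map V) a)) (AMap (Map V) f)"
    "Map (AMap ?T (f, Ident (Src V) b)) = Phi_arr \<Phi> (Ident (Cat M) X) (AMap (Map V) f)
        (Ident C (OMap (Map V) b))"
    if f: "f \<in> hom (Src V) a b" for f a b
    using f A.hom_obj[OF f] A.ident_hom[of a] A.ident_hom[of b]
    by (auto simp: Phi_along_def Phi_arr_def V.amap_ident hom_def)
  show ?thesis unfolding Str_end_def end_SET_def elts_vset[OF l] unfolding p
    using A.hom_obj by (simp add: m) blast
qed

lemma Str_end_in:
  "X \<in> Obj (Cat M) \<Longrightarrow> x \<in> elts (Str_end M \<Phi> V X) \<Longrightarrow> a \<in> Obj (Src V) \<Longrightarrow>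
    vapp x a \<in> Phi_obj \<Phi> X (OMap (Map V) a) (OMap (Map V) a)"
  using vapp_in[OF A.large_obj, of x "\<lambda>a. Phi_obj \<Phi> X (OMap (Map V) a) (OMap (Map V) a)"]
  by (simp add: in_Str_end)

lemma Str_end_extranatural:
  "X \<in> Obj (Cat M) \<Longrightarrow> x \<in> elts (Str_end M \<Phi> V X) \<Longrightarrow> f \<in> hom (Src V) a b \<Longrightarrow>
    Phi_arr \<Phi> (Ident (Cat M) X) (Ident C (OMap (Map V) a)) (AMap (Map V) f) (vapp x a) =
    Phi_arr \<Phi> (Ident (Cat M) X) (AMap (Map V) f) (Ident C (OMap (Map V) b)) (vapp x b)"
  by (simp add: in_Str_end)

lemma vapp_vlam_Src [simp]: "a \<in> Obj (Src V) \<Longrightarrow> vapp (vlam (Obj (Src V)) h) a = h a"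
  by (simp add: A.large_obj)

lemma vlam_in_Str_end:
  assumes X: "X \<in> Obj (Cat M)"
    and h: "\<And>a. a \<in> Obj (Src V) \<Longrightarrow> h a \<in> Phi_obj \<Phi> X (OMap (Map V) a) (OMap (Map V) a)"
    and n: "\<And>f a b. f \<in> hom (Src V) a b \<Longrightarrow>
      Phi_arr \<Phi> (Ident (Cat M) X) (Ident C (OMap (Map V) a)) (AMap (Map V) f) (h a) =
      Phi_arr \<Phi> (Ident (Cat M) X) (AMap (Map V) f) (Ident C (OMap (Map V) b)) (h b)"
  shows "vlam (Obj (Src V)) h \<in> elts (Str_end M \<Phi> V X)"
  unfolding in_Str_end[OF X] using n A.hom_obj by (auto intro!: vlam_in_vPi h)

lemma Str_end_eqI:
  assumes "X \<in> Obj (Cat M)" "x \<in> elts (Str_end M \<Phi> V X)" "y \<in> elts (Str_end M \<Phi> V X)"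
    and "\<And>a. a \<in> Obj (Src V) \<Longrightarrow> vapp x a = vapp y a"
  shows "x = y"
  using assms A.large_obj by (auto simp: in_Str_end intro: vPi_eqI)

section \<open>The theory carried by the ends\<close>

lemma lax_obj_Str [simp]: "X \<in> Obj (Cat M) \<Longrightarrow> lax_obj (Str_obj M C \<Phi> V) X = elts (Str_end M \<Phi> V X)"
  by (simp add: lax_obj_def Str_obj_def)

lemma vapp_lax_arr_Str [simp]:
  "u \<in> hom (Cat M) X' X \<Longrightarrow> x \<in> elts (Str_end M \<Phi> V X) \<Longrightarrow> a \<in> Obj (Src V) \<Longrightarrow>
    vapp (lax_arr (Str_obj M C \<Phi> V) u x) a =
    Phi_arr \<Phi> u (Ident C (OMap (Map V) a)) (Ident C (OMap (Map V) a)) (vapp x a)"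
  by (simp add: lax_arr_def Str_obj_def hom_def)

lemma vapp_LUnitElt_Str [simp]:
  "a \<in> Obj (Src V) \<Longrightarrow> vapp (LUnitElt (Str_obj M C \<Phi> V)) a = PhiUnit \<Phi> (OMap (Map V) a)"
  by (simp add: Str_obj_def)

lemma vapp_LMul_Str [simp]:
  "X \<in> Obj (Cat M) \<Longrightarrow> Y \<in> Obj (Cat M) \<Longrightarrow> y \<in> elts (Str_end M \<Phi> V Y) \<Longrightarrow>
    x \<in> elts (Str_end M \<Phi> V X) \<Longrightarrow> a \<in> Obj (Src V) \<Longrightarrow>
    vapp (LMul (Str_obj M C \<Phi> V) X Y y x) a =
    PhiMul \<Phi> X Y (OMap (Map V) a) (OMap (Map V) a) (OMap (Map V) a) (vapp y a) (vapp x a)"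
  by (simp add: Str_obj_def)

lemma Phi_arr_in_Str_end:
  assumes u: "u \<in> hom (Cat M) X' X" and x: "x \<in> elts (Str_end M \<Phi> V X)"
  shows "vlam (Obj (Src V)) (\<lambda>a. Phi_arr \<Phi> u (Ident C (OMap (Map V) a)) (Ident C (OMap (Map V) a))
      (vapp x a))
    \<in> elts (Str_end M \<Phi> V X')"
proof -
  have X: "X \<in> Obj (Cat M)" "X' \<in> Obj (Cat M)" using M.hom_obj[OF u] by auto
  show ?thesis
  proof (rule vlam_in_Str_end[OF X(2)])
    fix a assume a: "a \<in> Obj (Src V)"
    note o = V.omap_obj[OF a]
    show "Phi_arr \<Phi> u (Ident C (OMap (Map V) a)) (Ident C (OMap (Map V) a)) (vapp x a)
        \<in> Phi_obj \<Phi> X' (OMap (Map V) a) (OMap (Map V) a)"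
      by (rule Phi_arr_in[OF u C.ident_hom[OF o] C.ident_hom[OF o] Str_end_in[OF X(1) x a]])
  next
    fix f a b assume f: "f \<in> hom (Src V) a b"
    have o: "a \<in> Obj (Src V)" "b \<in> Obj (Src V)" using A.hom_obj[OF f] by auto
    note Vf = V.amap_hom[OF f] and i = C.ident_hom[OF V.omap_obj[OF o(1)]]
        C.ident_hom[OF V.omap_obj[OF o(2)]]
      and xa = Str_end_in[OF X(1) x o(1)] and xb = Str_end_in[OF X(1) x o(2)]
    show "Phi_arr \<Phi> (Ident (Cat M) X') (Ident C (OMap (Map V) a)) (AMap (Map V) f)
        (Phi_arr \<Phi> u (Ident C (OMap (Map V) a)) (Ident C (OMap (Map V) a)) (vapp x a)) =
      Phi_arr \<Phi> (Ident (Cat M) X') (AMap (Map V) f) (Ident C (OMap (Map V) b))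
        (Phi_arr \<Phi> u (Ident C (OMap (Map V) b)) (Ident C (OMap (Map V) b)) (vapp x b))"
      \<comment> \<open>On both sides \<open>u\<close> is moved to the outside; beneath it stand the
        two sides of the end condition of \<open>x\<close> along \<open>f\<close>.\<close>
      unfolding Phi_arr_right[OF u i(1) Vf xa] Phi_arr_right[OF u Vf i(2) xb]
        Phi_arr_left[OF u i(1) Vf xa, symmetric] Phi_arr_left[OF u Vf i(2) xb, symmetric]
        Str_end_extranatural[OF X(1) x f] ..
  qed
qed

lemma PhiUnit_in_Str_end:
  "vlam (Obj (Src V)) (\<lambda>a. PhiUnit \<Phi> (OMap (Map V) a)) \<in> elts (Str_end M \<Phi> V (Unit M))"
  by (rule vlam_in_Str_end[OF M.unit_obj unit_type[OF V.omap_obj] unit_extranatural[OF V.amap_hom]])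

text \<open>The image of \<open>f\<close> under \<open>V\<close> travels from the covariant outer
  slot to the contravariant one: into \<open>y\<close> by naturality, through \<open>y\<close> by
  its end condition, across the middle slot by extranaturality, through \<open>x\<close> by its end
  condition, and out by naturality. Meanwhile the three indices change from \<open>a\<close> to
  \<open>b\<close> one after the other.\<close>

lemma PhiMul_in_Str_end:
  assumes X: "X \<in> Obj (Cat M)" and Y: "Y \<in> Obj (Cat M)"
    and y: "y \<in> elts (Str_end M \<Phi> V Y)" and x: "x \<in> elts (Str_end M \<Phi> V X)"
  shows "vlam (Obj (Src V)) (\<lambda>a. PhiMul \<Phi> X Y (OMap (Map V) a) (OMap (Map V) a) (OMap (Map V) a)
      (vapp y a) (vapp x a)) \<in> elts (Str_end M \<Phi> V (tensor_obj M Y X))"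
proof (rule vlam_in_Str_end)
  show "tensor_obj M Y X \<in> Obj (Cat M)" using M.tensor.omap_obj[of "(Y, X)"] X Y by simp
  show "PhiMul \<Phi> X Y (OMap (Map V) a) (OMap (Map V) a) (OMap (Map V) a) (vapp y a) (vapp x a)
      \<in> Phi_obj \<Phi> (tensor_obj M Y X) (OMap (Map V) a) (OMap (Map V) a)" if a: "a \<in> Obj (Src V)"
          for a
    using V.omap_obj[OF a] Str_end_in[OF Y y a] Str_end_in[OF X x a] X Y by (intro mul_type)
next
  fix f a b assume f: "f \<in> hom (Src V) a b"
  have a: "a \<in> Obj (Src V)" and b: "b \<in> Obj (Src V)" using A.hom_obj[OF f] by auto
  note Va = V.omap_obj[OF a] and Vb = V.omap_obj[OF b] and Vf = V.amap_hom[OF f]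
  note ya = Str_end_in[OF Y y a] and yb = Str_end_in[OF Y y b]
    and xa = Str_end_in[OF X x a] and xb = Str_end_in[OF X x b]
  let ?a = "OMap (Map V) a" and ?b = "OMap (Map V) b" and ?f = "AMap (Map V) f"
  let ?i = "Ident (Cat M)" and ?j = "Ident C"
  have "Phi_arr \<Phi> (?i (tensor_obj M Y X)) (?j ?a) ?f (PhiMul \<Phi> X Y ?a ?a ?a (vapp y a) (vapp x a)) =
      PhiMul \<Phi> X Y ?a ?a ?b (Phi_arr \<Phi> (?i Y) (?j ?a) ?f (vapp y a)) (vapp x a)"
    by (rule mul_natural_left[OF X Y Va Va Vf ya xa, symmetric])
  also have "\<dots> = PhiMul \<Phi> X Y ?a ?a ?b (Phi_arr \<Phi> (?i Y) ?f (?j ?b) (vapp y b)) (vapp x a)"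
    by (simp only: Str_end_extranatural[OF Y y f])
  also have "\<dots> = PhiMul \<Phi> X Y ?a ?b ?b (vapp y b) (Phi_arr \<Phi> (?i X) (?j ?a) ?f (vapp x a))"
    by (rule mul_extranatural[OF X Y Va Vf Vb yb xa, symmetric])
  also have "\<dots> = PhiMul \<Phi> X Y ?a ?b ?b (vapp y b) (Phi_arr \<Phi> (?i X) ?f (?j ?b) (vapp x b))"
    by (simp only: Str_end_extranatural[OF X x f])
  also have "\<dots> = Phi_arr \<Phi> (?i (tensor_obj M Y X)) ?f (?j ?b)
      (PhiMul \<Phi> X Y ?b ?b ?b (vapp y b) (vapp x b))"
    by (rule mul_natural_right[OF X Y Vf Vb Vb yb xb])
  finally show "Phi_arr \<Phi> (?i (tensor_obj M Y X)) (?j ?a) ?f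
      (PhiMul \<Phi> X Y ?a ?a ?a (vapp y a) (vapp x a)) =
      Phi_arr \<Phi> (?i (tensor_obj M Y X)) ?f (?j ?b) (PhiMul \<Phi> X Y ?b ?b ?b (vapp y b) (vapp x b))" .
qed

lemma LFun_Str_functor: "is_functor (opp (Cat M)) SET (LFun (Str_obj M C \<Phi> V))"
proof -
  let ?E = "Str_end M \<Phi> V"
  let ?U = "\<lambda>u x. vlam (Obj (Src V)) (\<lambda>a. Phi_arr \<Phi> u (Ident C (OMap (Map V) a))
              (Ident C (OMap (Map V) a)) (vapp x a))"
  let ?A = "\<lambda>u. Arrow (?E (Cod (Cat M) u)) (\<lambda>x\<in>elts (?E (Cod (Cat M) u)). ?U u x)
      (?E (Dom (Cat M) u))"
  interpret S: category SET by (rule category_SET)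
  have h: "?A u \<in> hom SET (?E X) (?E X')" if u: "u \<in> hom (opp (Cat M)) X X'" for u X X'
    unfolding in_hom_SET using u Phi_arr_in_Str_end[of u X' X] by (auto simp: hom_def)
  have "is_functor (opp (Cat M)) SET (mk_func (opp (Cat M)) ?E ?A)"
  proof (rule is_functor_mk_func[OF category_opp[OF M.category_axioms] category_SET _ h])
    fix X assume X: "X \<in> Obj (opp (Cat M))"
    then have i: "Ident (Cat M) X \<in> hom (opp (Cat M)) X X" using M.ident_hom by simp
    have "?A (Ident (Cat M) X) = Ident SET (?E X)"
    proof (rule hom_SET_eqI[OF h[OF i] S.ident_hom])
      fix x assume x: "x \<in> elts (?E X)"
      have "?U (Ident (Cat M) X) x = x"
        by (rule Str_end_eqI[OF _ Phi_arr_in_Str_end[OF _ x] x])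
          (use X i x in \<open>simp_all add: Phi_arr_ident V.omap_obj Str_end_in\<close>)
      then show "Map (?A (Ident (Cat M) X)) x = Map (Ident SET (?E X)) x"
        using M.ident_hom[of X] X x by (simp add: hom_def)
    qed simp
    then show "?A (Ident (opp (Cat M)) X) = Ident SET (?E X)" using X by simp
  next
    fix u v X Y Z assume u: "u \<in> hom (opp (Cat M)) X Y" and v: "v \<in> hom (opp (Cat M)) Y Z"
    then have u': "u \<in> hom (Cat M) Y X" and v': "v \<in> hom (Cat M) Z Y" by auto
    have uv: "Comp (Cat M) u v \<in> hom (Cat M) Z X" by (rule M.comp_hom[OF v' u'])
    have o: "X \<in> Obj (Cat M)" "Z \<in> Obj (Cat M)" using M.hom_obj[OF uv] by auto
    have "?A (Comp (Cat M) u v) = Comp SET (?A v) (?A u)"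
    proof (rule hom_SET_eqI[OF h S.comp_hom[OF h[OF u] h[OF v]]])
      show "Comp (Cat M) u v \<in> hom (opp (Cat M)) X Z" using uv by simp
      fix x assume x: "x \<in> elts (?E X)"
      note ux = Phi_arr_in_Str_end[OF u' x]
      have "?U (Comp (Cat M) u v) x = ?U v (?U u x)"
      proof (rule Str_end_eqI[OF o(2) Phi_arr_in_Str_end[OF uv x] Phi_arr_in_Str_end[OF v' ux]])
        fix a assume a: "a \<in> Obj (Src V)"
        note i = C.ident_hom[OF V.omap_obj[OF a]]
        show "vapp (?U (Comp (Cat M) u v) x) a = vapp (?U v (?U u x)) a"
          using Phi_arr_comp[OF u' v' i i i i Str_end_in[OF o(1) x a]] a C.comp_ident_left[OF i]
              by simp
      qed
      then show "Map (?A (Comp (Cat M) u v)) x = Map (Comp SET (?A v) (?A u)) x"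
        using u' v' uv x ux Map_Comp_SET[OF h[OF u] h[OF v] x] by (simp add: hom_def)
    qed
    then show "?A (Comp (opp (Cat M)) v u) = Comp SET (?A v) (?A u)" by simp
  qed simp
  then show ?thesis by (simp add: Str_obj_def)
qed

lemma lax_arr_Str_in:
  "u \<in> hom (Cat M) X' X \<Longrightarrow> x \<in> elts (Str_end M \<Phi> V X) \<Longrightarrow>
    lax_arr (Str_obj M C \<Phi> V) u x \<in> elts (Str_end M \<Phi> V X')"
  using Phi_arr_in_Str_end[of u X' X x] by (simp add: lax_arr_def Str_obj_def hom_def)

lemma LUnitElt_Str_in: "LUnitElt (Str_obj M C \<Phi> V) \<in> elts (Str_end M \<Phi> V (Unit M))"
  using PhiUnit_in_Str_end by (simp add: Str_obj_def)

lemma LMul_Str_in: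
  "X \<in> Obj (Cat M) \<Longrightarrow> Y \<in> Obj (Cat M) \<Longrightarrow> y \<in> elts (Str_end M \<Phi> V Y) \<Longrightarrow>
    x \<in> elts (Str_end M \<Phi> V X) \<Longrightarrow>
    LMul (Str_obj M C \<Phi> V) X Y y x \<in> elts (Str_end M \<Phi> V (tensor_obj M Y X))"
  using PhiMul_in_Str_end[of X Y y x] by (simp add: Str_obj_def)

text \<open>Elements of an end are equal once they agree at every \<open>a\<close>, and all
  operations are computed there. So each law is the metamodel law with all its \<open>C\<close>
  variables equal to the image of \<open>a\<close> under \<open>V\<close>.\<close>

lemma lax_Str_obj: "lax_monoidal_functor M (Str_obj M C \<Phi> V)"
proof -
  interpret L: is_functor "opp (Cat M)" SET "LFun (Str_obj M C \<Phi> V)" by (rule LFun_Str_functor)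
  have T: "tensor_obj M Y X \<in> Obj (Cat M)" if "X \<in> Obj (Cat M)" "Y \<in> Obj (Cat M)" for X Y
    using M.tensor.omap_obj[of "(Y, X)"] that by simp
  show ?thesis
  proof
    show "LUnitElt (Str_obj M C \<Phi> V) \<in> lax_obj (Str_obj M C \<Phi> V) (Unit M)"
      using LUnitElt_Str_in M.unit_obj by simp
    show "LMul (Str_obj M C \<Phi> V) \<in> (\<Pi>\<^sub>E X\<in>Obj (Cat M). \<Pi>\<^sub>E Y\<in>Obj (Cat M).
        lax_obj (Str_obj M C \<Phi> V) Y \<rightarrow>\<^sub>E lax_obj (Str_obj M C \<Phi> V) X \<rightarrow>\<^sub>E
          lax_obj (Str_obj M C \<Phi> V) (tensor_obj M Y X))"
    proof (intro PiE_I)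
      fix X Y y x assume "X \<in> Obj (Cat M)" "Y \<in> Obj (Cat M)"
        "y \<in> lax_obj (Str_obj M C \<Phi> V) Y" "x \<in> lax_obj (Str_obj M C \<Phi> V) X"
      then show "LMul (Str_obj M C \<Phi> V) X Y y x \<in> lax_obj (Str_obj M C \<Phi> V) (tensor_obj M Y X)"
        using LMul_Str_in T by simp
    qed (simp_all add: Str_obj_def lax_obj_def)
  next
    fix u v X X' Y Y' x y
    assume u: "u \<in> hom (Cat M) X' X" and v: "v \<in> hom (Cat M) Y' Y"
      and "y \<in> lax_obj (Str_obj M C \<Phi> V) Y" and "x \<in> lax_obj (Str_obj M C \<Phi> V) X"
    moreover have o: "X \<in> Obj (Cat M)" "X' \<in> Obj (Cat M)" "Y \<in> Obj (Cat M)" "Y' \<in> Obj (Cat M)"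
      using M.hom_obj[OF u] M.hom_obj[OF v] by auto
    ultimately have y: "y \<in> elts (Str_end M \<Phi> V Y)" and x: "x \<in> elts (Str_end M \<Phi> V X)" by auto
    have vu: "tensor_arr M v u \<in> hom (Cat M) (tensor_obj M Y' X') (tensor_obj M Y X)"
      using M.tensor.amap_hom[of "(v, u)" "(Y', X')" "(Y, X)"] u v by simp
    show "LMul (Str_obj M C \<Phi> V) X' Y' (lax_arr (Str_obj M C \<Phi> V) v y)
        (lax_arr (Str_obj M C \<Phi> V) u x) =
        lax_arr (Str_obj M C \<Phi> V) (tensor_arr M v u) (LMul (Str_obj M C \<Phi> V) X Y y x)"
    proof (rule Str_end_eqI[OF T[OF o(2,4)]
          LMul_Str_in[OF o(2,4) lax_arr_Str_in[OF v y] lax_arr_Str_in[OF u x]]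
          lax_arr_Str_in[OF vu LMul_Str_in[OF o(1,3) y x]]])
      fix a assume a: "a \<in> Obj (Src V)"
      note Va = V.omap_obj[OF a]
      note i = C.ident_hom[OF Va]
      show "vapp (LMul (Str_obj M C \<Phi> V) X' Y' (lax_arr (Str_obj M C \<Phi> V) v y)
          (lax_arr (Str_obj M C \<Phi> V) u x)) a =
          vapp (lax_arr (Str_obj M C \<Phi> V) (tensor_arr M v u) (LMul (Str_obj M C \<Phi> V) X Y y x)) a"
        using mul_natural[OF u v i Va i Str_end_in[OF o(3) y a] Str_end_in[OF o(1) x a]]
        by (simp add: o a x y vapp_lax_arr_Str[OF u] vapp_lax_arr_Str[OF v] vapp_lax_arr_Str[OF vu]
            lax_arr_Str_in[OF u] lax_arr_Str_in[OF v] LMul_Str_in)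
    qed
  next
    fix X x assume X: "X \<in> Obj (Cat M)" and "x \<in> lax_obj (Str_obj M C \<Phi> V) X"
    then have x: "x \<in> elts (Str_end M \<Phi> V X)" by simp
    note l = M.lunit_hom[OF X] and r = M.runit_hom[OF X]
    show "LMul (Str_obj M C \<Phi> V) X (Unit M) (LUnitElt (Str_obj M C \<Phi> V)) x =
        lax_arr (Str_obj M C \<Phi> V) (LUnit M X) x"
      by (rule Str_end_eqI[OF T[OF X M.unit_obj] LMul_Str_in[OF X M.unit_obj LUnitElt_Str_in x]
          lax_arr_Str_in[OF l x]])
        (simp add: X M.unit_obj LUnitElt_Str_in x vapp_lax_arr_Str[OF l] mul_unit_left V.omap_obj
          Str_end_in)
    show "LMul (Str_obj M C \<Phi> V) (Unit M) X x (LUnitElt (Str_obj M C \<Phi> V)) =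
        lax_arr (Str_obj M C \<Phi> V) (RUnit M X) x"
      by (rule Str_end_eqI[OF T[OF M.unit_obj X] LMul_Str_in[OF M.unit_obj X x LUnitElt_Str_in]
          lax_arr_Str_in[OF r x]])
        (simp add: X M.unit_obj LUnitElt_Str_in x vapp_lax_arr_Str[OF r] mul_unit_right V.omap_obj
          Str_end_in)
  next
    fix X Y Z x y z assume o: "X \<in> Obj (Cat M)" "Y \<in> Obj (Cat M)" "Z \<in> Obj (Cat M)"
      and "x \<in> lax_obj (Str_obj M C \<Phi> V) X" "y \<in> lax_obj (Str_obj M C \<Phi> V) Y" "z \<in>
          lax_obj (Str_obj M C \<Phi> V) Z"
    then have e: "x \<in> elts (Str_end M \<Phi> V X)" "y \<in> elts (Str_end M \<Phi> V Y)" "z \<in>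
        elts (Str_end M \<Phi> V Z)"
      by auto
    note l = LMul_Str_in[OF T[OF o(1,2)] o(3) e(3) LMul_Str_in[OF o(1,2) e(2,1)]]
    note r = M.assoc_hom[OF o(3,2,1)]
    show "LMul (Str_obj M C \<Phi> V) X (tensor_obj M Z Y) (LMul (Str_obj M C \<Phi> V) Y Z z y) x =
        lax_arr (Str_obj M C \<Phi> V) (Assoc M Z Y X)
          (LMul (Str_obj M C \<Phi> V) (tensor_obj M Y X) Z z (LMul (Str_obj M C \<Phi> V) X Y y x))"
      by (rule Str_end_eqI[OF T[OF o(1) T[OF o(2,3)]]
            LMul_Str_in[OF o(1) T[OF o(2,3)] LMul_Str_in[OF o(2,3) e(3,2)] e(1)]
                lax_arr_Str_in[OF r l]])
        (simp add: o e T LMul_Str_in l vapp_lax_arr_Str[OF r l] V.omap_obj Str_end_in mul_assoc)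
  qed
qed

section \<open>Families of models and theory arrows into an end\<close>

lemma family_to_Str_hom:
  assumes P: "lax_monoidal_functor M P" and g: "model_family M C \<Phi> P V g"
  shows "family_to_Str M C \<Phi> P V g \<in> hom (Th M) P (Str_obj M C \<Phi> V)"
proof -
  interpret P: lax_monoidal_functor M P by fact
  interpret g: model_family M C \<Phi> P V g by fact
  let ?h = "\<lambda>X p. vlam (Obj (Src V)) (\<lambda>a. g X p a)"
  let ?t = "\<lambda>X\<in>Obj (Cat M). Arrow (OMap (LFun P) X) (\<lambda>p\<in>lax_obj P X. ?h X p) (Str_end M \<Phi> V X)"
  have h: "?h X p \<in> elts (Str_end M \<Phi> V X)" if "X \<in> Obj (Cat M)" "p \<in> lax_obj P X" for X p
    using that by (intro vlam_in_Str_end g.family_in g.family_extranatural)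
  have T: "tensor_obj M Y X \<in> Obj (Cat M)" if "X \<in> Obj (Cat M)" "Y \<in> Obj (Cat M)" for X Y
    using M.tensor.omap_obj[of "(Y, X)"] that by simp
  have "monoidal_nat_trans M P (Str_obj M C \<Phi> V) ?t"
  proof (rule monoidal_nat_transI[OF P lax_Str_obj])
    show "?t X \<in> hom SET (OMap (LFun P) X) (OMap (LFun (Str_obj M C \<Phi> V)) X)" if "X \<in> Obj (Cat M)"
        for X
      using that h by (auto simp: in_hom_SET lax_obj_def Str_obj_def)
  next
    fix u X X' p assume u: "u \<in> hom (Cat M) X' X" and p: "p \<in> lax_obj P X"
    have o: "X \<in> Obj (Cat M)" "X' \<in> Obj (Cat M)" using M.hom_obj[OF u] by auto
    note up = P.lax_arr_in[OF u p]
    have "?h X' (lax_arr P u p) = lax_arr (Str_obj M C \<Phi> V) u (?h X p)"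
      by (rule Str_end_eqI[OF o(2) h[OF o(2) up] lax_arr_Str_in[OF u h[OF o(1) p]]])
        (simp add: vapp_lax_arr_Str[OF u] h o p g.family_natural[OF _ u])
    then show "Map (?t X') (lax_arr P u p) = lax_arr (Str_obj M C \<Phi> V) u (Map (?t X) p)"
      using o p up by simp
  next
    have "?h (Unit M) (LUnitElt P) = LUnitElt (Str_obj M C \<Phi> V)"
      by (rule Str_end_eqI[OF M.unit_obj h[OF M.unit_obj P.lax_unit_type] LUnitElt_Str_in])
        (simp add: g.family_unit)
    then show "Map (?t (Unit M)) (LUnitElt P) = LUnitElt (Str_obj M C \<Phi> V)"
      using M.unit_obj P.lax_unit_type by simp
  next
    fix X Y y x assume o: "X \<in> Obj (Cat M)" "Y \<in> Obj (Cat M)"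
        and e: "y \<in> lax_obj P Y" "x \<in> lax_obj P X"
    note yx = P.lax_mul_in[OF o e]
    have "?h (tensor_obj M Y X) (LMul P X Y y x) = LMul (Str_obj M C \<Phi> V) X Y (?h Y y) (?h X x)"
      by (rule Str_end_eqI[OF T[OF o] h[OF T[OF o] yx]
          LMul_Str_in[OF o h[OF o(2) e(1)] h[OF o(1) e(2)]]])
        (simp add: o e h g.family_mul)
    then show "Map (?t (tensor_obj M Y X)) (LMul P X Y y x) =
        LMul (Str_obj M C \<Phi> V) X Y (Map (?t Y) y) (Map (?t X) x)"
      using o e yx T by simp
  qed simp
  then show ?thesis by (simp add: in_hom_Th family_to_Str_def)
qed

lemma Str_family_family_to_Str [simp]:
  "a \<in> Obj (Src V) \<Longrightarrow> X \<in> Obj (Cat M) \<Longrightarrow> p \<in> lax_obj P X \<Longrightarrow>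
    Str_family (family_to_Str M C \<Phi> P V g) X p a = g X p a"
  by (simp add: Str_family_def family_to_Str_def)

lemma Str_family_is_family:
  assumes t: "t \<in> hom (Th M) P (Str_obj M C \<Phi> V)"
  shows "model_family M C \<Phi> P V (Str_family t)"
proof -
  interpret t: monoidal_nat_trans M P "Str_obj M C \<Phi> V" "Map t" using t by (simp add: in_hom_Th)
  have m: "Map (Map t X) p \<in> elts (Str_end M \<Phi> V X)" if "X \<in> Obj (Cat M)" "p \<in> lax_obj P X" for X p
    using t.map_in[OF that] that by simp
  show ?thesis
  proof
    fix a u X' X p assume a: "a \<in> Obj (Src V)" and u: "u \<in> hom (Cat M) X' X"
        and p: "p \<in> lax_obj P X"
    show "Str_family t X' (lax_arr P u p) a =
      Phi_arr \<Phi> u (Ident C (OMap (Map V) a)) (Ident C (OMap (Map V) a)) (Str_family t X p a)"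
      using a p m M.hom_obj[OF u] by (simp add: Str_family_def t.map_natural[OF u p]
          vapp_lax_arr_Str[OF u])
  qed (simp_all add: Str_family_def m Str_end_in Str_end_extranatural t.preserves_unit
      t.preserves_mul)
qed

lemma hom_Str_eqI:
  assumes s: "s \<in> hom (Th M) P (Str_obj M C \<Phi> V)" and t: "t \<in> hom (Th M) P (Str_obj M C \<Phi> V)"
    and eq: "\<And>a X p. a \<in> Obj (Src V) \<Longrightarrow> X \<in> Obj (Cat M) \<Longrightarrow> p \<in> lax_obj P X \<Longrightarrow>
      Str_family s X p a = Str_family t X p a"
  shows "s = t"
proof (rule hom_Th_eqI[OF s t])
  interpret s: monoidal_nat_trans M P "Str_obj M C \<Phi> V" "Map s" using s by (simp add: in_hom_Th)
  interpret t: monoidal_nat_trans M P "Str_obj M C \<Phi> V" "Map t" using t by (simp add: in_hom_Th)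
  fix X p assume X: "X \<in> Obj (Cat M)" and p: "p \<in> lax_obj P X"
  show "Map (Map s X) p = Map (Map t X) p"
    by (rule Str_end_eqI[OF X]) (use X p s.map_in t.map_in eq in \<open>simp_all add: Str_family_def\<close>)
qed

end

text \<open>The tautological family on the theory of \<open>W\<close> evaluates an element of the
  end at an object of the domain of \<open>W\<close>. Reindexing it along \<open>F\<close> gives
  \<open>Str_arr\<close>, so its typing is a case of \<open>family_to_Str_hom\<close>.\<close>

lemma Str_arr_eq_family:
  assumes F: "F \<in> hom slice_C V W"
  shows "Str_arr M C \<Phi> F =
    family_to_Str M C \<Phi> (Str_obj M C \<Phi> W) V (\<lambda>X x a. vapp x (OMap (Map (Map F)) a))"
proof -
  have W: "W \<in> Obj slice_C" and st: "Src F = V" "Tgt F = W" using F by (auto simp: in_hom_slice_CAT)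
  show ?thesis
    using lax_obj_Str[OF W]
    by (auto simp: Str_arr_def family_to_Str_def st
        Str_obj_def[of M C \<Phi> W, THEN arg_cong[where f = LFun]]
        fun_eq_iff)
qed

text \<open>The equations \<open>o\<close> and \<open>m\<close>, read off from the triangle over
  \<open>C\<close>, identify values of \<open>W\<close> along \<open>F\<close> with values of
  \<open>V\<close>; the laws then come from the theory of \<open>W\<close> at the images of the
  \<open>a\<close>.\<close>

lemma Str_arr_family:
  assumes F: "F \<in> hom slice_C V W"
  shows "model_family M C \<Phi> (Str_obj M C \<Phi> W) V (\<lambda>X x a. vapp x (OMap (Map (Map F)) a))"
proof -
  have V: "V \<in> Obj slice_C" and W: "W \<in> Obj slice_C" using F by (auto simp: in_hom_slice_CAT)
  interpret F: is_functor "Src V" "Src W" "Map (Map F)" using F by (simp add: in_hom_slice_CAT)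
  have FV: "comp_func (Src V) (Map W) (Map (Map F)) = Map V" using F by (simp add: in_hom_slice_CAT)
  have o: "OMap (Map W) (OMap (Map (Map F)) a) = OMap (Map V) a" if "a \<in> Obj (Src V)" for a
    using that by (simp flip: FV)
  have m: "AMap (Map W) (AMap (Map (Map F)) f) = AMap (Map V) f" if "f \<in> hom (Src V) a b" for f a b
    using that by (simp flip: FV)
  show ?thesis
  proof
    fix a X x assume a: "a \<in> Obj (Src V)" and "X \<in> Obj (Cat M)" "x \<in> lax_obj (Str_obj M C \<Phi> W) X"
    then show "vapp x (OMap (Map (Map F)) a) \<in> Phi_obj \<Phi> X (OMap (Map V) a) (OMap (Map V) a)"
      using Str_end_in[OF W, of X x "OMap (Map (Map F)) a"] F.omap_obj[OF a] by (simp add: W o)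
  next
    fix a u X' X x assume a: "a \<in> Obj (Src V)" and u: "u \<in> hom (Cat M) X' X"
      and "x \<in> lax_obj (Str_obj M C \<Phi> W) X"
    then show "vapp (lax_arr (Str_obj M C \<Phi> W) u x) (OMap (Map (Map F)) a) =
       Phi_arr \<Phi> u (Ident C (OMap (Map V) a)) (Ident C (OMap (Map V) a))
           (vapp x (OMap (Map (Map F)) a))"
      using M.hom_obj[OF u] F.omap_obj[OF a] by (simp add: W vapp_lax_arr_Str[OF W u] o)
  next
    fix f a b X x assume f: "f \<in> hom (Src V) a b" and "X \<in> Obj (Cat M)" "x \<in>
        lax_obj (Str_obj M C \<Phi> W) X"
    then show "Phi_arr \<Phi> (Ident (Cat M) X) (Ident C (OMap (Map V) a)) (AMap (Map V) f)
        (vapp x (OMap (Map (Map F)) a)) =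
       Phi_arr \<Phi> (Ident (Cat M) X) (AMap (Map V) f) (Ident C (OMap (Map V) b))
           (vapp x (OMap (Map (Map F)) b))"
      using Str_end_extranatural[OF W _ _ F.amap_hom[OF f], of X x] F.A.hom_obj[OF f]
          by (simp add: W o m[OF f])
  qed (simp_all add: W o F.omap_obj)
qed

lemma Str_arr_hom:
  assumes F: "F \<in> hom slice_C V W"
  shows "Str_arr M C \<Phi> F \<in> hom (Th M) (Str_obj M C \<Phi> W) (Str_obj M C \<Phi> V)"
proof -
  have "V \<in> Obj slice_C" "W \<in> Obj slice_C" using F by (auto simp: in_hom_slice_CAT)
  then show ?thesis
    unfolding Str_arr_eq_family[OF F] by (intro family_to_Str_hom lax_Str_obj Str_arr_family[OF F])
qed

text \<open>The same reindexing in \<open>a\<close> that \<open>Sem_family_Comp\<close> gives on the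
  other side; their agreement is naturality of the bijection in \<open>V\<close>.\<close>

lemma Str_family_Comp_Str_arr:
  assumes F: "F \<in> hom slice_C V W" and t: "t \<in> hom (Th M) P (Str_obj M C \<Phi> W)"
    and a: "a \<in> Obj (Src V)" and X: "X \<in> Obj (Cat M)" and p: "p \<in> lax_obj P X"
  shows "Str_family (Comp (Th M) (Str_arr M C \<Phi> F) t) X p a =
      Str_family t X p (OMap (Map (Map F)) a)"
proof -
  interpret t: monoidal_nat_trans M P "Str_obj M C \<Phi> W" "Map t" using t by (simp add: in_hom_Th)
  have V: "V \<in> Obj slice_C" using F by (simp add: in_hom_slice_CAT)
  show ?thesis
    using Str_family_family_to_Str[OF V a X t.map_in[OF X p]]
    unfolding Str_family_def Map_Comp_Th[OF Str_arr_hom[OF F] t X p]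
    unfolding Str_arr_eq_family[OF F] .
qed

lemma Str_functor: "is_functor slice_C (opp (Th M)) (Str M C \<Phi>)"
proof -
  interpret T: category "Th M" by (rule category_Th)
  interpret K: category slice_C by (rule category_slice_CAT)
  have fam: "Str_family (Str_arr M C \<Phi> F) X x a = vapp x (OMap (Map (Map F)) a)"
    if "F \<in> hom slice_C V W" "V \<in> Obj slice_C" "a \<in> Obj (Src V)" "X \<in> Obj (Cat M)"
      "x \<in> lax_obj (Str_obj M C \<Phi> W) X" for F V W X x a
    using that by (simp add: Str_arr_eq_family)
  show ?thesis unfolding Str_def
  proof (rule is_functor_mk_func[OF category_slice_CAT category_opp[OF category_Th]])
    fix V assume V: "V \<in> Obj slice_C"
    note i = K.ident_hom[OF V] and L = lax_Str_obj[OF V]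
    have i': "Ident (Th M) (Str_obj M C \<Phi> V) \<in> hom (Th M) (Str_obj M C \<Phi> V) (Str_obj M C \<Phi> V)"
      using T.ident_hom L by simp
    have "Str_arr M C \<Phi> (Ident slice_C V) = Ident (Th M) (Str_obj M C \<Phi> V)"
      \<comment> \<open>\<open>fam\<close> is applied while the identity of the slice is still
        folded; the second pass unfolds it.\<close>
      by (rule hom_Str_eqI[OF V Str_arr_hom[OF i] i'])
        (simp add: fam[OF i V], simp add: Ident_slice_CAT V Str_family_def Map_Ident_Th L)
    then show "Str_arr M C \<Phi> (Ident slice_C V) = Ident (opp (Th M)) (Str_obj M C \<Phi> V)"
      using L by simp
  next
    fix F G U V W assume F: "F \<in> hom slice_C U V" and G: "G \<in> hom slice_C V W"
    note GF = K.comp_hom[OF F G]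
    have o: "U \<in> Obj slice_C" "V \<in> Obj slice_C" using K.hom_obj[OF F] by auto
    interpret F: is_functor "Src U" "Src V" "Map (Map F)" using F by (simp add: in_hom_slice_CAT)
    have "Str_arr M C \<Phi> (Comp slice_C G F) = Comp (Th M) (Str_arr M C \<Phi> F) (Str_arr M C \<Phi> G)"
      by (rule hom_Str_eqI[OF o(1) Str_arr_hom[OF GF]
          T.comp_hom[OF Str_arr_hom[OF G] Str_arr_hom[OF F]]])
        (simp add: fam[OF GF o(1)] Str_family_Comp_Str_arr[OF F Str_arr_hom[OF G]] fam[OF G o(2)]
          F.omap_obj,
          simp add: Comp_slice_CAT[OF F G])
    then show "Str_arr M C \<Phi> (Comp slice_C G F) = Comp (opp (Th M)) (Str_arr M C \<Phi> G)
        (Str_arr M C \<Phi> F)"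
      by simp
  qed (simp_all add: lax_Str_obj Str_arr_hom)
qed

section \<open>The bijection of hom sets and the adjunction\<close>

lemma bij_betw_Str_Sem:
  assumes V: "V \<in> Obj slice_C" and P: "lax_monoidal_functor M P"
  shows "bij_betw (\<lambda>t. family_to_Sem M C \<Phi> P V (Str_family t))
    (hom (Th M) P (Str_obj M C \<Phi> V)) (hom slice_C V (Sem_obj M C \<Phi> P))"
proof (rule bij_betw_byWitness[where f' = "\<lambda>F. family_to_Str M C \<Phi> P V (Sem_family F)"])
  have S: "family_to_Sem M C \<Phi> P V (Str_family t) \<in> hom slice_C V (Sem_obj M C \<Phi> P)"
    if "t \<in> hom (Th M) P (Str_obj M C \<Phi> V)" for t
    by (rule family_to_Sem_hom[OF P V Str_family_is_family[OF V that]])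
  have T: "family_to_Str M C \<Phi> P V (Sem_family F) \<in> hom (Th M) P (Str_obj M C \<Phi> V)"
    if "F \<in> hom slice_C V (Sem_obj M C \<Phi> P)" for F
    by (rule family_to_Str_hom[OF V P Sem_family_is_family[OF that]])
  show "\<forall>t\<in>hom (Th M) P (Str_obj M C \<Phi> V).
      family_to_Str M C \<Phi> P V (Sem_family (family_to_Sem M C \<Phi> P V (Str_family t))) = t"
    by (auto intro!: hom_Str_eqI[OF V T[OF S]] simp: V)
  show "\<forall>F\<in>hom slice_C V (Sem_obj M C \<Phi> P).
      family_to_Sem M C \<Phi> P V (Str_family (family_to_Str M C \<Phi> P V (Sem_family F))) = F"
    by (auto intro!: hom_Sem_eqI[OF S[OF T]] simp: V)
qed (use V P in \<open>auto intro: family_to_Sem_hom Str_family_is_family family_to_Str_hom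
    Sem_family_is_family\<close>)

lemma Str_left_adjoint_Sem: "left_adjoint slice_C (opp (Th M)) (Str M C \<Phi>) (Sem M C \<Phi>)"
  unfolding left_adjoint_def
proof (intro conjI exI ballI)
  interpret T: category "Th M" by (rule category_Th)
  interpret K: category slice_C by (rule category_slice_CAT)
  let ?\<theta> = "\<lambda>V P t. family_to_Sem M C \<Phi> P V (Str_family t)"
  show "bij_betw (?\<theta> V P) (hom (opp (Th M)) (OMap (Str M C \<Phi>) V) P)
      (hom slice_C V (OMap (Sem M C \<Phi>) P))"
    if "V \<in> Obj slice_C" "P \<in> Obj (opp (Th M))" for V P
  proof -
    have "hom (opp (Th M)) (Str_obj M C \<Phi> V) P = hom (Th M) P (Str_obj M C \<Phi> V)" by auto
    then show ?thesis using that bij_betw_Str_Sem[of V P] by (simp add: Str_def Sem_def)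
  qed
  fix V V' P P' F s t
  assume V: "V \<in> Obj slice_C" and V': "V' \<in> Obj slice_C"
    and "P \<in> Obj (opp (Th M))" "P' \<in> Obj (opp (Th M))"
    and F: "F \<in> hom slice_C V' V" and "s \<in> hom (opp (Th M)) P P'"
    and "t \<in> hom (opp (Th M)) (OMap (Str M C \<Phi>) V) P"
  then have P: "lax_monoidal_functor M P" "lax_monoidal_functor M P'"
    and s: "s \<in> hom (Th M) P' P" and t: "t \<in> hom (Th M) P (Str_obj M C \<Phi> V)"
    by (auto simp: Str_def)
  interpret s: monoidal_nat_trans M P' P "Map s" using s by (simp add: in_hom_Th)
  interpret F: is_functor "Src V'" "Src V" "Map (Map F)" using F by (simp add: in_hom_slice_CAT)
  note Ft = T.comp_hom[OF t Str_arr_hom[OF F]]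
  note Fts = T.comp_hom[OF s Ft]
  have \<theta>: "?\<theta> V P t \<in> hom slice_C V (Sem_obj M C \<Phi> P)"
    by (rule family_to_Sem_hom[OF P(1) V Str_family_is_family[OF V t]])
  note \<theta>F = K.comp_hom[OF F \<theta>]
  \<comment> \<open>The composite from \<open>left_adjoint\<close> is reversed, since its arrows
    live in \<open>opp (Th M)\<close>. Both sides have as value at \<open>X\<close>,
    \<open>p\<close>, \<open>a\<close> the family of \<open>t\<close> at the image of
    \<open>p\<close> under \<open>s\<close> and the image of \<open>a\<close> under
    \<open>F\<close>.\<close>
  have "?\<theta> V' P' (Comp (Th M) (Comp (Th M) (Str_arr M C \<Phi> F) t) s) =
      Comp slice_C (Sem_arr M C \<Phi> s) (Comp slice_C (?\<theta> V P t) F)"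
  proof (rule hom_Sem_eqI[OF family_to_Sem_hom[OF P(2) V' Str_family_is_family[OF V' Fts]]
        K.comp_hom[OF \<theta>F Sem_arr_hom[OF s]]])
    fix a X p assume a: "a \<in> Obj (Src V')" and X: "X \<in> Obj (Cat M)" and p: "p \<in> lax_obj P' X"
    note sp = s.map_in[OF X p] and Fa = F.omap_obj[OF a]
    have "Sem_family (?\<theta> V' P' (Comp (Th M) (Comp (Th M) (Str_arr M C \<Phi> F) t) s)) X p a =
        Str_family (Comp (Th M) (Str_arr M C \<Phi> F) t) X (Map (Map s X) p) a"
      using a X p by (simp add: Str_family_def Map_Comp_Th[OF Ft s])
    also have "\<dots> = Str_family t X (Map (Map s X) p) (OMap (Map (Map F)) a)"
      by (rule Str_family_Comp_Str_arr[OF F t a X sp])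
    also have "\<dots> = Sem_family (Comp slice_C (Sem_arr M C \<Phi> s) (Comp slice_C (?\<theta> V P t) F)) X p a"
      using Fa X sp by (simp add: Sem_family_Comp_Sem_arr[OF s \<theta>F a X p] Sem_family_Comp[OF F \<theta> a])
    finally show "Sem_family (?\<theta> V' P' (Comp (Th M) (Comp (Th M) (Str_arr M C \<Phi> F) t) s)) X p a =
        Sem_family (Comp slice_C (Sem_arr M C \<Phi> s) (Comp slice_C (?\<theta> V P t) F)) X p a" .
  qed
  moreover have "AMap (Str M C \<Phi>) F = Str_arr M C \<Phi> F" using F by (simp add: Str_def)
  moreover have "AMap (Sem M C \<Phi>) s = Sem_arr M C \<Phi> s" using s by (simp add: Sem_def hom_def)
  ultimately show "?\<theta> V' P' (Comp (opp (Th M)) s (Comp (opp (Th M)) t (AMap (Str M C \<Phi>) F))) =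
      Comp slice_C (AMap (Sem M C \<Phi>) s) (Comp slice_C (?\<theta> V P t) F)"
    by simp
qed (rule Str_functor Sem_functor)+

end

theorem theorem4p1:
  fixes M :: "('v::universe, 'v) moncat"
    and C :: "('v, 'v) category"
    and \<Phi> :: "'v metamodel_data"
  assumes "large_monoidal_category M"
    and "large_category C"
    and "metamodel M C \<Phi>"
  shows "left_adjoint (slice CAT C) (opp (Th M)) (Str M C \<Phi>) (Sem M C \<Phi>)"
proof -
  interpret large_metamodel M C \<Phi> using assms by (simp add: large_metamodel_def)
  show ?thesis by (rule Str_left_adjoint_Sem)
qed

end
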